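(* Let $C$ and $C'$ be two bounded, uniformly elliptic elasticity tensors on $\Omega$, and let $V$ and $V'$ be finite-dimensional subspaces of $(H^1_0(\Omega))^d$. For $b\in(L^2(\Omega))^d$ let $u\in (H^1_0(\Omega))^d$ be the weak solution of $-\operatorname{div}(C:\varepsilon(u))=b$ in $\Omega$, $u=0$ on $\partial\Omega$, and let $u'\in(H^1_0(\Omega))^d$ be the weak solution of $-\operatorname{div}(C':\varepsilon(u'))=b$ in $\Omega$, $u'=0$ on $\partial\Omega$. If $(\operatorname{div} C:\varepsilon(V))=(\operatorname{div} C':\varepsilon(V'))$ as subspaces of $(H^{-1}(\Omega))^d$, then $$\sup_{b\in(L^2(\Omega))^d}\ \inf_{v\in V}\frac{\|u-v\|_{C\text{-flux}}}{\|b\|_{(L^2(\Omega))^d}}=\sup_{b\in(L^2(\Omega))^d}\ \inf_{v\in V'}\frac{\|u'-v\|_{C'\text{-flux}}}{\|b\|_{(L^2(\Omega))^d}},$$ where the suprema are over $b\ne0$.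
   Context: $\Omega\subset\mathbb{R}^d$ ($d\ge2$) is a bounded domain with $C^2$ boundary. An elasticity tensor $C=(C_{ijkl})$ is a fourth-order tensor with $C_{ijkl}\in L^\infty(\Omega)$ and the usual symmetries $C_{ijkl}=C_{jikl}=C_{ijlk}=C_{klij}$, uniformly elliptic: there are $0<\lambda_{\min}(C)\le\lambda_{\max}(C)<\infty$ with $\lambda_{\min}(C)|\xi|^2\le\xi:C(x):\xi\le\lambda_{\max}(C)|\xi|^2$ for all symmetric $\xi\in\mathbb{R}^{d\times d}$ and a.e. $x$. Here $(C:\zeta)_{ij}=\sum_{k,l}C_{ijkl}\zeta_{kl}$, $\varepsilon_{ij}(\psi)=\frac12(\partial_j\psi_i+\partial_i\psi_j)$, and the divergence of a matrix field is taken row-wise. For $k\in(L^2(\Omega))^{d\times d}$, $k_{pot}$ is the $L^2$-orthogonal projection of $k$ onto the closure of $\{\nabla g: g\in(C_0^\infty(\Omega))^d\}$ in $(L^2(\Omega))^{d\times d}$. For $\psi\in(H^1_0(\Omega))^d$, $\|\psi\|_{C\text{-flux}}:=\|(C:\varepsilon(\psi))_{pot}\|_{(L^2(\Omega))^{d\times d}}$. For a finite-dimensional subspace $V\subset(H_0^1(\Omega))^d$, $(\operatorname{div}C:\varepsilon(V)):=\operatorname{span}\{\operatorname{div}(C:\varepsilon(v)): v\in V\}$. *)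

theory Defs
  imports "HOL-Analysis.Analysis" "HOL-Library.Function_Algebras"
begin

text \<open>
  Scalar fields, vector fields and matrix fields on a domain \<open>\<Omega>\<close> in \<open>real ^ 'd\<close> are total functions
  on \<open>real ^ 'd\<close> of which only the values on \<open>\<Omega>\<close> matter. Elements of \<open>L\<^sup>2(\<Omega>)\<close>, \<open>H\<^sup>1(\<Omega>)\<close>,
  \<open>H\<^sup>1\<^sub>0(\<Omega>)\<close> are handled through representatives: equality in these spaces is equality almost
  everywhere on \<open>\<Omega>\<close>. Inner product and norm on \<open>real ^ 'd ^ 'd\<close> are those of Frobenius.
\<close>

instantiation "fun" :: (type, real_vector) real_vector
begin

definition scaleR_fun :: "real \<Rightarrow> ('a \<Rightarrow> 'b) \<Rightarrow> 'a \<Rightarrow> 'b"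
  where "scaleR_fun c f = (\<lambda>x. c *\<^sub>R f x)"

instance
  by standard (auto simp: scaleR_fun_def fun_eq_iff scaleR_add_right scaleR_add_left)

end

subsection \<open>Smooth functions and domains\<close>

text \<open>\<open>C\<^sup>n\<close> functions on an open set.\<close>

primrec Ck_on ::
  "nat \<Rightarrow> 'a set \<Rightarrow> ('a::real_normed_vector \<Rightarrow> 'b::real_normed_vector) \<Rightarrow> bool" where
  "Ck_on 0 S f \<longleftrightarrow> continuous_on S f"
| "Ck_on (Suc n) S f \<longleftrightarrow>
     (\<forall>x\<in>S. f differentiable (at x)) \<and> (\<forall>v. Ck_on n S (\<lambda>x. frechet_derivative f (at x) v))"

definition test_functions :: "(real^'d) set \<Rightarrow> (real^'d \<Rightarrow> 'b::real_normed_vector) set" where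
  "test_functions \<Omega> =
     {\<phi>. (\<forall>n. Ck_on n UNIV \<phi>) \<and> (\<exists>K. compact K \<and> K \<subseteq> \<Omega> \<and> (\<forall>x. x \<notin> K \<longrightarrow> \<phi> x = 0))}"

text \<open>
  Near each boundary point the domain is, in suitable orthonormal coordinates, the open region on
  one side of the graph of a \<open>C\<^sup>2\<close> function of \<open>d - 1\<close> variables. Such a function is encoded as a
  function on \<open>real ^ 'd\<close> that does not depend on the \<open>k\<close>-th coordinate.
\<close>

definition C2_boundary :: "(real^'d) set \<Rightarrow> bool" where
  "C2_boundary \<Omega> \<longleftrightarrow>
     (\<forall>p\<in>frontier \<Omega>. \<exists>r>0. \<exists>Q k. \<exists>\<gamma>::real^'d \<Rightarrow> real.
        orthogonal_transformation Q \<and>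
        Ck_on 2 UNIV \<gamma> \<and> (\<forall>y t. \<gamma> (y + t *\<^sub>R axis k 1) = \<gamma> y) \<and>
        \<Omega> \<inter> ball p r = {x \<in> ball p r. Q x $ k > \<gamma> (Q x)})"

definition C2_bounded_domain :: "(real^'d) set \<Rightarrow> bool" where
  "C2_bounded_domain \<Omega> \<longleftrightarrow>
     \<Omega> \<noteq> {} \<and> open \<Omega> \<and> connected \<Omega> \<and> bounded \<Omega> \<and> C2_boundary \<Omega>"

subsection \<open>Square integrable fields and Sobolev spaces\<close>

definition L2 :: "(real^'d) set \<Rightarrow> (real^'d \<Rightarrow> 'b::euclidean_space) set" where
  "L2 \<Omega> = {f. f \<in> borel_measurable (lebesgue_on \<Omega>) \<and>
               integrable (lebesgue_on \<Omega>) (\<lambda>x. (norm (f x))\<^sup>2)}"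

definition L2_inner ::
  "(real^'d) set \<Rightarrow> (real^'d \<Rightarrow> 'b::euclidean_space) \<Rightarrow> (real^'d \<Rightarrow> 'b) \<Rightarrow> real" where
  "L2_inner \<Omega> f g = (\<integral>x. f x \<bullet> g x \<partial>lebesgue_on \<Omega>)"

definition L2_norm :: "(real^'d) set \<Rightarrow> (real^'d \<Rightarrow> 'b::euclidean_space) \<Rightarrow> real" where
  "L2_norm \<Omega> f = sqrt (L2_inner \<Omega> f f)"

text \<open>\<open>G $ i $ j\<close> is the weak derivative of the \<open>i\<close>-th component in direction \<open>j\<close>, as for
  \<^const>\<open>jacobian\<close>.\<close>

definition is_weak_gradient ::
  "(real^'d) set \<Rightarrow> (real^'d \<Rightarrow> real^'d) \<Rightarrow> (real^'d \<Rightarrow> real^'d^'d) \<Rightarrow> bool" where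
  "is_weak_gradient \<Omega> u G \<longleftrightarrow> G \<in> L2 \<Omega> \<and>
     (\<forall>\<phi>\<in>test_functions \<Omega>. \<forall>i j.
        (\<integral>x. u x $ i * frechet_derivative \<phi> (at x) (axis j 1) \<partial>lebesgue_on \<Omega>)
        = - (\<integral>x. G x $ i $ j * \<phi> x \<partial>lebesgue_on \<Omega>))"

definition H1 :: "(real^'d) set \<Rightarrow> (real^'d \<Rightarrow> real^'d) set" where
  "H1 \<Omega> = {u \<in> L2 \<Omega>. \<exists>G. is_weak_gradient \<Omega> u G}"

definition weak_gradient ::
  "(real^'d) set \<Rightarrow> (real^'d \<Rightarrow> real^'d) \<Rightarrow> (real^'d \<Rightarrow> real^'d^'d)" where
  "weak_gradient \<Omega> u = (SOME G. is_weak_gradient \<Omega> u G)"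

definition H1_norm :: "(real^'d) set \<Rightarrow> (real^'d \<Rightarrow> real^'d) \<Rightarrow> real" where
  "H1_norm \<Omega> u = sqrt ((L2_norm \<Omega> u)\<^sup>2 + (L2_norm \<Omega> (weak_gradient \<Omega> u))\<^sup>2)"

definition H10 :: "(real^'d) set \<Rightarrow> (real^'d \<Rightarrow> real^'d) set" where
  "H10 \<Omega> = {u \<in> H1 \<Omega>. \<exists>\<phi>::nat \<Rightarrow> real^'d \<Rightarrow> real^'d.
               (\<forall>n. \<phi> n \<in> test_functions \<Omega>) \<and> (\<lambda>n. H1_norm \<Omega> (u - \<phi> n)) \<longlonglongrightarrow> 0}"

text \<open>
  A subspace of \<open>H\<^sup>1\<^sub>0(\<Omega>)\<close> is represented by the set of all representatives of its members, and its
  finite dimensionality is understood modulo equality almost everywhere.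
\<close>

definition finite_dim_subspace_H10 ::
  "(real^'d) set \<Rightarrow> (real^'d \<Rightarrow> real^'d) set \<Rightarrow> bool" where
  "finite_dim_subspace_H10 \<Omega> V \<longleftrightarrow>
     V \<subseteq> H10 \<Omega> \<and> subspace V \<and>
     (\<forall>v\<in>V. \<forall>w. (AE x in lebesgue_on \<Omega>. v x = w x) \<longrightarrow> w \<in> V) \<and>
     (\<exists>B. finite B \<and> B \<subseteq> V \<and> (\<forall>v\<in>V. \<exists>w\<in>span B. AE x in lebesgue_on \<Omega>. v x = w x))"

subsection \<open>Elasticity\<close>

definition tensor_apply :: "real^'d^'d^'d^'d \<Rightarrow> real^'d^'d \<Rightarrow> real^'d^'d" where
  "tensor_apply A \<zeta> = (\<chi> i j. \<Sum>k\<in>UNIV. \<Sum>l\<in>UNIV. A $ i $ j $ k $ l * \<zeta> $ k $ l)"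

definition elasticity_tensor :: "(real^'d) set \<Rightarrow> (real^'d \<Rightarrow> real^'d^'d^'d^'d) \<Rightarrow> bool" where
  "elasticity_tensor \<Omega> C \<longleftrightarrow>
     (\<forall>i j k l. (\<lambda>x. C x $ i $ j $ k $ l) \<in> borel_measurable (lebesgue_on \<Omega>) \<and>
        (\<exists>M. AE x in lebesgue_on \<Omega>. \<bar>C x $ i $ j $ k $ l\<bar> \<le> M)) \<and>
     (AE x in lebesgue_on \<Omega>. \<forall>i j k l.
        C x $ i $ j $ k $ l = C x $ j $ i $ k $ l \<and>
        C x $ i $ j $ k $ l = C x $ i $ j $ l $ k \<and>
        C x $ i $ j $ k $ l = C x $ k $ l $ i $ j) \<and>
     (\<exists>lmin lmax. 0 < lmin \<and> lmin \<le> lmax \<and>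
        (AE x in lebesgue_on \<Omega>. \<forall>\<xi>. transpose \<xi> = \<xi> \<longrightarrow>
           lmin * (norm \<xi>)\<^sup>2 \<le> \<xi> \<bullet> tensor_apply (C x) \<xi> \<and>
           \<xi> \<bullet> tensor_apply (C x) \<xi> \<le> lmax * (norm \<xi>)\<^sup>2))"

definition strain ::
  "(real^'d) set \<Rightarrow> (real^'d \<Rightarrow> real^'d) \<Rightarrow> (real^'d \<Rightarrow> real^'d^'d)" where
  "strain \<Omega> \<psi> =
     (\<lambda>x. \<chi> i j. (weak_gradient \<Omega> \<psi> x $ i $ j + weak_gradient \<Omega> \<psi> x $ j $ i) / 2)"

definition stress ::
  "(real^'d) set \<Rightarrow> (real^'d \<Rightarrow> real^'d^'d^'d^'d) \<Rightarrow> (real^'d \<Rightarrow> real^'d) \<Rightarrow> (real^'d \<Rightarrow> real^'d^'d)"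
  where "stress \<Omega> C \<psi> = (\<lambda>x. tensor_apply (C x) (strain \<Omega> \<psi> x))"

text \<open>
  \<open>H\<^sup>-\<^sup>1(\<Omega>)\<close> is the dual of \<open>H\<^sup>1\<^sub>0(\<Omega>)\<close>; its elements are represented as functionals that vanish
  outside \<^term>\<open>H10 \<Omega>\<close>. The row-wise divergence of a square integrable matrix field \<open>k\<close> acts by
  \<open>\<phi> \<mapsto> - \<integral> k : \<nabla>\<phi>\<close>, and an \<open>L\<^sup>2\<close> vector field acts by integration.
\<close>

definition div_functional ::
  "(real^'d) set \<Rightarrow> (real^'d \<Rightarrow> real^'d^'d) \<Rightarrow> (real^'d \<Rightarrow> real^'d) \<Rightarrow> real" where
  "div_functional \<Omega> k =
     (\<lambda>\<phi>. if \<phi> \<in> H10 \<Omega> then - L2_inner \<Omega> k (weak_gradient \<Omega> \<phi>) else 0)"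

definition L2_functional ::
  "(real^'d) set \<Rightarrow> (real^'d \<Rightarrow> real^'d) \<Rightarrow> (real^'d \<Rightarrow> real^'d) \<Rightarrow> real" where
  "L2_functional \<Omega> b = (\<lambda>\<phi>. if \<phi> \<in> H10 \<Omega> then L2_inner \<Omega> b \<phi> else 0)"

definition weak_solution ::
  "(real^'d) set \<Rightarrow> (real^'d \<Rightarrow> real^'d^'d^'d^'d) \<Rightarrow> (real^'d \<Rightarrow> real^'d) \<Rightarrow> (real^'d \<Rightarrow> real^'d) \<Rightarrow> bool"
  where "weak_solution \<Omega> C b u \<longleftrightarrow>
           u \<in> H10 \<Omega> \<and> - div_functional \<Omega> (stress \<Omega> C u) = L2_functional \<Omega> b"

definition div_space ::
  "(real^'d) set \<Rightarrow> (real^'d \<Rightarrow> real^'d^'d^'d^'d) \<Rightarrow> (real^'d \<Rightarrow> real^'d) set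
     \<Rightarrow> ((real^'d \<Rightarrow> real^'d) \<Rightarrow> real) set"
  where "div_space \<Omega> C V = span ((\<lambda>v. div_functional \<Omega> (stress \<Omega> C v)) ` V)"

subsection \<open>The flux norm\<close>

definition potential_fields :: "(real^'d) set \<Rightarrow> (real^'d \<Rightarrow> real^'d^'d) set" where
  "potential_fields \<Omega> =
     {p \<in> L2 \<Omega>. \<exists>g::nat \<Rightarrow> real^'d \<Rightarrow> real^'d.
        (\<forall>n. g n \<in> test_functions \<Omega>) \<and>
        (\<lambda>n. L2_norm \<Omega> (\<lambda>x. p x - jacobian (g n) (at x))) \<longlonglongrightarrow> 0}"

text \<open>The orthogonal projection of \<open>k\<close> onto \<^term>\<open>potential_fields \<Omega>\<close> (unique almost everywhere).\<close>

definition pot ::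
  "(real^'d) set \<Rightarrow> (real^'d \<Rightarrow> real^'d^'d) \<Rightarrow> (real^'d \<Rightarrow> real^'d^'d)" where
  "pot \<Omega> k = (SOME p. p \<in> potential_fields \<Omega> \<and>
                       (\<forall>q\<in>potential_fields \<Omega>. L2_inner \<Omega> (k - p) q = 0))"

definition flux_norm ::
  "(real^'d) set \<Rightarrow> (real^'d \<Rightarrow> real^'d^'d^'d^'d) \<Rightarrow> (real^'d \<Rightarrow> real^'d) \<Rightarrow> real" where
  "flux_norm \<Omega> C \<psi> = L2_norm \<Omega> (pot \<Omega> (stress \<Omega> C \<psi>))"

end

theory Submission
  imports Defs
begin

text \<open>
  The potential part of a field \<open>k\<close> is determined by the pairings of \<open>k\<close> with gradients of test
  functions, that is, by the distribution \<open>div k\<close>. So \<open>\<parallel>u - v\<parallel>\<close> in the flux norm of \<open>C\<close> depends only on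
  \<open>div (C : \<epsilon>(u)) - div (C : \<epsilon>(v)) = - b - div (C : \<epsilon>(v))\<close>. As \<open>v\<close> runs through \<open>V\<close>, the last term
  runs through \<open>div (C : \<epsilon>(V))\<close>, which is the same space for \<open>C'\<close> and \<open>V'\<close>; hence for every \<open>b\<close> the two
  infima range over the same set of values. Since \<^const>\<open>weak_gradient\<close> is a choice, this needs that
  weak gradients are unique almost everywhere and agree with the classical ones on test functions.
\<close>

subsection \<open>Square integrable fields\<close>

text \<open>The choice behind \<open>weak_gradient\<close> intervenes twice. The stress of
  \<open>u - v\<close> is only almost everywhere the difference of the two stresses, so linearity
  becomes an exact equality only after integration, that is, at the level of
  \<open>div_functional\<close>. And \<open>div_functional\<close> pairs a field with the weak
  gradient of a test function, whereas \<open>potential_fields\<close> is built from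
  \<open>jacobian\<close>; the two pairings have to be identified. Both points rest on the
  fundamental lemma of the calculus of variations and, for the second, on integration by parts. The
  fundamental lemma is tested with explicit products of profiles \<open>exp (- c / t)\<close>: as
  \<open>c\<close> tends to 0 they converge to the indicator of an open box, and open boxes generate
  the Borel sets.\<close>

lemma L2_measurable: "f \<in> L2 \<Omega> \<Longrightarrow> f \<in> borel_measurable (lebesgue_on \<Omega>)"
  by (simp add: L2_def)

text \<open>The codomains may differ, so this one domination bound covers multiples, entries of
  vector fields and products with bounded coefficients.\<close>

lemma L2_bound:
  fixes f :: "real^'d \<Rightarrow> 'b::euclidean_space" and g :: "real^'d \<Rightarrow> 'c::euclidean_space"
  assumes f: "f \<in> L2 \<Omega>" and g: "g \<in> borel_measurable (lebesgue_on \<Omega>)"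
    and le: "AE x in lebesgue_on \<Omega>. norm (g x) \<le> c * norm (f x)"
  shows "g \<in> L2 \<Omega>"
proof -
  have "integrable (lebesgue_on \<Omega>) (\<lambda>x. (norm (g x))\<^sup>2)"
  proof (rule Bochner_Integration.integrable_bound)
    show "integrable (lebesgue_on \<Omega>) (\<lambda>x. c\<^sup>2 * (norm (f x))\<^sup>2)"
      using f by (simp add: L2_def)
    show "(\<lambda>x. (norm (g x))\<^sup>2) \<in> borel_measurable (lebesgue_on \<Omega>)"
      using g by measurable
    show "AE x in lebesgue_on \<Omega>. norm ((norm (g x))\<^sup>2) \<le> norm (c\<^sup>2 * (norm (f x))\<^sup>2)"
      using le
    proof eventually_elim
      case (elim x)
      then have "(norm (g x))\<^sup>2 \<le> (c * norm (f x))\<^sup>2"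
        by (intro power_mono) auto
      then show ?case
        by (simp add: power_mult_distrib)
    qed
  qed
  with g show ?thesis
    by (simp add: L2_def)
qed

lemma L2_scaleR: "f \<in> L2 \<Omega> \<Longrightarrow> (\<lambda>x. c *\<^sub>R f x) \<in> L2 \<Omega>"
  by (rule L2_bound[where f = f and c = "\<bar>c\<bar>"]) (auto dest: L2_measurable)

lemma L2_add:
  assumes "f \<in> L2 \<Omega>" "g \<in> L2 \<Omega>"
  shows "(\<lambda>x. f x + g x) \<in> L2 \<Omega>"
proof -
  have [measurable]: "f \<in> borel_measurable (lebesgue_on \<Omega>)" "g \<in> borel_measurable (lebesgue_on \<Omega>)"
    using assms by (auto dest: L2_measurable)
  have "integrable (lebesgue_on \<Omega>) (\<lambda>x. (norm (f x + g x))\<^sup>2)"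
  proof (rule Bochner_Integration.integrable_bound)
    show "integrable (lebesgue_on \<Omega>) (\<lambda>x. 2 * (norm (f x))\<^sup>2 + 2 * (norm (g x))\<^sup>2)"
      using assms by (simp add: L2_def)
    show "AE x in lebesgue_on \<Omega>.
        norm ((norm (f x + g x))\<^sup>2) \<le> norm (2 * (norm (f x))\<^sup>2 + 2 * (norm (g x))\<^sup>2)"
    proof (rule AE_I2)
      fix x
      have "(norm (f x + g x))\<^sup>2 \<le> (norm (f x) + norm (g x))\<^sup>2"
        by (intro power_mono norm_triangle_ineq) auto
      also have "\<dots> \<le> 2 * (norm (f x))\<^sup>2 + 2 * (norm (g x))\<^sup>2"
        using sum_squares_bound[of "norm (f x)" "norm (g x)"] by (simp add: power2_sum)
      finally show "norm ((norm (f x + g x))\<^sup>2) \<le> norm (2 * (norm (f x))\<^sup>2 + 2 * (norm (g x))\<^sup>2)"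
        by simp
    qed
  qed measurable
  then show ?thesis
    by (simp add: L2_def)
qed

lemma L2_diff:
  assumes "f \<in> L2 \<Omega>" "g \<in> L2 \<Omega>"
  shows "(\<lambda>x. f x - g x) \<in> L2 \<Omega>"
  using L2_add[OF assms(1) L2_scaleR[OF assms(2), of "-1"]] by simp

lemma L2_zero: "(\<lambda>x. 0) \<in> L2 \<Omega>"
  by (simp add: L2_def)

lemma L2_sum: "(\<And>i. i \<in> I \<Longrightarrow> f i \<in> L2 \<Omega>) \<Longrightarrow> (\<lambda>x. \<Sum>i\<in>I. f i x) \<in> L2 \<Omega>"
  by (induction I rule: infinite_finite_induct) (auto intro: L2_add L2_zero)

lemma L2_bounded_support:
  fixes f :: "real^'d \<Rightarrow> 'b::euclidean_space"
  assumes \<Omega>: "\<Omega> \<in> sets lebesgue" and f: "f \<in> borel_measurable borel"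
    and K: "compact K" "\<And>x. x \<notin> K \<Longrightarrow> f x = 0" and M: "\<And>x. norm (f x) \<le> M"
  shows "f \<in> L2 \<Omega>"
proof -
  have meas: "f \<in> borel_measurable lebesgue"
    using f by (simp add: measurable_completion)
  have "integrable lebesgue (\<lambda>x. (norm (f x))\<^sup>2)"
  proof (rule Bochner_Integration.integrable_bound)
    show "integrable lebesgue (\<lambda>x. M\<^sup>2 * indicator K x)"
      using lmeasurable_compact[OF K(1)]
      by (intro integrable_mult_right integrable_real_indicator) (auto simp: fmeasurable_def)
    show "(\<lambda>x. (norm (f x))\<^sup>2) \<in> borel_measurable lebesgue"
      using meas by measurable
    show "AE x in lebesgue. norm ((norm (f x))\<^sup>2) \<le> norm (M\<^sup>2 * indicator K x)"
    proof (rule AE_I2)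
      fix x
      show "norm ((norm (f x))\<^sup>2) \<le> norm (M\<^sup>2 * indicator K x)"
        using K(2)[of x] power_mono[OF M[of x], of 2] by (cases "x \<in> K") auto
    qed
  qed
  from integrable_mult_indicator[OF \<Omega> this]
  have "integrable (lebesgue_on \<Omega>) (\<lambda>x. (norm (f x))\<^sup>2)"
    using \<Omega> by (simp add: integrable_restrict_space)
  with meas show ?thesis
    by (simp add: L2_def measurable_restrict_space1)
qed

lemma L2_continuous_support:
  fixes f :: "real^'d \<Rightarrow> 'b::euclidean_space"
  assumes \<Omega>: "\<Omega> \<in> sets lebesgue" and f: "continuous_on UNIV f"
    and K: "compact K" "\<And>x. x \<notin> K \<Longrightarrow> f x = 0"
  shows "f \<in> L2 \<Omega>"
proof -
  have "bounded (f ` K)"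
    by (intro compact_imp_bounded compact_continuous_image K continuous_on_subset[OF f]) simp
  then obtain M where "M > 0" "\<And>x. x \<in> K \<Longrightarrow> norm (f x) \<le> M"
    by (auto simp: bounded_pos)
  then have "norm (f x) \<le> M" for x
    using K(2)[of x] by (cases "x \<in> K") auto
  then show ?thesis
    using L2_bounded_support[OF \<Omega> borel_measurable_continuous_onI[OF f] K] by blast
qed

text \<open>Both sides reduce to the same scalar coordinates, because the basis of the vector type
  consists of the \<open>axis i b\<close> with \<open>b\<close> in the basis of the entries. With
  Euclidean entries allowed, a second application reaches the entries of a matrix field.\<close>

lemma borel_measurable_vec_iff:
  fixes f :: "'a \<Rightarrow> 'b::euclidean_space ^ 'n"
  shows "f \<in> borel_measurable M \<longleftrightarrow> (\<forall>i. (\<lambda>x. f x $ i) \<in> borel_measurable M)"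
  unfolding borel_measurable_euclidean_space[of f]
  by (subst borel_measurable_euclidean_space) (auto simp: Basis_vec_def inner_axis)

lemma L2_vec_iff:
  fixes f :: "real^'d \<Rightarrow> 'b::euclidean_space ^ 'n"
  shows "f \<in> L2 \<Omega> \<longleftrightarrow> (\<forall>i. (\<lambda>x. f x $ i) \<in> L2 \<Omega>)"
proof (intro iffI allI)
  fix i assume f: "f \<in> L2 \<Omega>"
  then show "(\<lambda>x. f x $ i) \<in> L2 \<Omega>"
    by (intro L2_bound[OF f, where c = 1])
      (auto dest: L2_measurable simp: borel_measurable_vec_iff[of f] Finite_Cartesian_Product.norm_nth_le)
next
  assume "\<forall>i. (\<lambda>x. f x $ i) \<in> L2 \<Omega>"
  moreover have "(norm (f x))\<^sup>2 = (\<Sum>i\<in>UNIV. (norm (f x $ i))\<^sup>2)" for x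
    by (simp add: norm_vec_def L2_set_def sum_nonneg)
  ultimately show "f \<in> L2 \<Omega>"
    by (simp add: L2_def borel_measurable_vec_iff[of f])
qed

lemma integrable_inner_L2:
  assumes "f \<in> L2 \<Omega>" "g \<in> L2 \<Omega>"
  shows "integrable (lebesgue_on \<Omega>) (\<lambda>x. f x \<bullet> g x)"
proof (rule Bochner_Integration.integrable_bound)
  have [measurable]: "f \<in> borel_measurable (lebesgue_on \<Omega>)" "g \<in> borel_measurable (lebesgue_on \<Omega>)"
    using assms by (auto dest: L2_measurable)
  show "integrable (lebesgue_on \<Omega>) (\<lambda>x. (norm (f x))\<^sup>2 + (norm (g x))\<^sup>2)"
    using assms by (simp add: L2_def)
  show "(\<lambda>x. f x \<bullet> g x) \<in> borel_measurable (lebesgue_on \<Omega>)"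
    by measurable
  show "AE x in lebesgue_on \<Omega>. norm (f x \<bullet> g x) \<le> norm ((norm (f x))\<^sup>2 + (norm (g x))\<^sup>2)"
  proof (rule AE_I2)
    fix x
    have "\<bar>f x \<bullet> g x\<bar> \<le> norm (f x) * norm (g x)"
      by (rule Cauchy_Schwarz_ineq2)
    moreover have "2 * (norm (f x) * norm (g x)) \<le> (norm (f x))\<^sup>2 + (norm (g x))\<^sup>2"
      using sum_squares_bound[of "norm (f x)" "norm (g x)"] by simp
    moreover have "0 \<le> norm (f x) * norm (g x)"
      by simp
    ultimately show "norm (f x \<bullet> g x) \<le> norm ((norm (f x))\<^sup>2 + (norm (g x))\<^sup>2)"
      by simp
  qed
qed

section \<open>The \<open>L\<^sup>2\<close> pairing: bilinearity, Cauchy-Schwarz, continuity\<close>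

lemma L2_inner_commute: "L2_inner \<Omega> f g = L2_inner \<Omega> g f"
  by (simp add: L2_inner_def inner_commute)

lemma L2_inner_add_left:
  assumes "f \<in> L2 \<Omega>" "g \<in> L2 \<Omega>" "h \<in> L2 \<Omega>"
  shows "L2_inner \<Omega> (\<lambda>x. f x + g x) h = L2_inner \<Omega> f h + L2_inner \<Omega> g h"
  using assms by (simp add: L2_inner_def inner_add_left integrable_inner_L2)

lemma L2_inner_diff_left:
  assumes "f \<in> L2 \<Omega>" "g \<in> L2 \<Omega>" "h \<in> L2 \<Omega>"
  shows "L2_inner \<Omega> (\<lambda>x. f x - g x) h = L2_inner \<Omega> f h - L2_inner \<Omega> g h"
  using assms by (simp add: L2_inner_def inner_diff_left integrable_inner_L2)

lemma L2_inner_diff_right: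
  assumes "f \<in> L2 \<Omega>" "g \<in> L2 \<Omega>" "h \<in> L2 \<Omega>"
  shows "L2_inner \<Omega> h (\<lambda>x. f x - g x) = L2_inner \<Omega> h f - L2_inner \<Omega> h g"
  using L2_inner_diff_left[OF assms] by (simp add: L2_inner_commute)

lemma L2_inner_scaleR_left: "L2_inner \<Omega> (\<lambda>x. c *\<^sub>R f x) g = c * L2_inner \<Omega> f g"
  by (simp add: L2_inner_def)

text \<open>Turns identities between weak gradients or stresses, known only almost everywhere, into
  exact equalities of pairings.\<close>

lemma L2_inner_cong_AE:
  assumes "f \<in> L2 \<Omega>" "f' \<in> L2 \<Omega>" "g \<in> L2 \<Omega>" "g' \<in> L2 \<Omega>"
    and "AE x in lebesgue_on \<Omega>. f x = f' x" "AE x in lebesgue_on \<Omega>. g x = g' x"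
  shows "L2_inner \<Omega> f g = L2_inner \<Omega> f' g'"
  unfolding L2_inner_def
proof (rule integral_cong_AE)
  have [measurable]: "f \<in> borel_measurable (lebesgue_on \<Omega>)" "g \<in> borel_measurable (lebesgue_on \<Omega>)"
     "f' \<in> borel_measurable (lebesgue_on \<Omega>)" "g' \<in> borel_measurable (lebesgue_on \<Omega>)"
    using assms by (auto dest: L2_measurable)
  show "(\<lambda>x. f x \<bullet> g x) \<in> borel_measurable (lebesgue_on \<Omega>)"
    "(\<lambda>x. f' x \<bullet> g' x) \<in> borel_measurable (lebesgue_on \<Omega>)"
    by measurable
  show "AE x in lebesgue_on \<Omega>. f x \<bullet> g x = f' x \<bullet> g' x"
    using assms(5,6) by eventually_elim simp
qed

lemma L2_inner_self_nonneg: "0 \<le> L2_inner \<Omega> f f"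
  by (simp add: L2_inner_def)

text \<open>The squared norm of \<open>f - t g\<close> is a nonnegative quadratic in
  \<open>t\<close>. On representatives the pairing is only semidefinite:
  \<open>L2_inner \<Omega> g g = 0\<close> does not make \<open>g\<close> the zero function, hence
  the separate degenerate case.\<close>

lemma L2_inner_Cauchy_Schwarz:
  assumes f: "f \<in> L2 \<Omega>" and g: "g \<in> L2 \<Omega>"
  shows "\<bar>L2_inner \<Omega> f g\<bar> \<le> L2_norm \<Omega> f * L2_norm \<Omega> g"
proof -
  let ?a = "L2_inner \<Omega> f f" and ?b = "L2_inner \<Omega> g g" and ?p = "L2_inner \<Omega> f g"
  have quad: "0 \<le> ?a - 2 * t * ?p + t\<^sup>2 * ?b" for t
  proof -
    let ?h = "\<lambda>x. f x - t *\<^sub>R g x"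
    have tg: "(\<lambda>x. t *\<^sub>R g x) \<in> L2 \<Omega>"
      by (rule L2_scaleR[OF g])
    have h: "?h \<in> L2 \<Omega>"
      by (rule L2_diff[OF f tg])
    have "L2_inner \<Omega> ?h ?h = L2_inner \<Omega> f ?h - t * L2_inner \<Omega> g ?h"
      using L2_inner_diff_left[OF f tg h] by (simp add: L2_inner_scaleR_left)
    moreover have "L2_inner \<Omega> k ?h = L2_inner \<Omega> k f - t * L2_inner \<Omega> k g" if "k \<in> L2 \<Omega>" for k
      using L2_inner_diff_right[OF f tg that]
      by (simp add: L2_inner_scaleR_left L2_inner_commute[of \<Omega> k])
    ultimately have "L2_inner \<Omega> ?h ?h = ?a - 2 * t * ?p + t\<^sup>2 * ?b"
      using f g by (simp add: algebra_simps power2_eq_square L2_inner_commute[of \<Omega> g f])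
    then show ?thesis
      using L2_inner_self_nonneg[of \<Omega> ?h] by simp
  qed
  have "?p\<^sup>2 \<le> ?a * ?b"
  proof (cases "?b = 0")
    case True
    \<comment> \<open>With \<open>?b = 0\<close> the quadratic is the affine function
      \<open>?a - 2 * t * ?p\<close>; for \<open>?p\<close> nonzero the chosen \<open>t\<close>
      gives it the value -1.\<close>
    have "?p = 0"
      using quad[of "(?a + 1) / (2 * ?p)"] True by (cases "?p = 0") auto
    then show ?thesis
      using True by simp
  next
    case False
    then have "0 < ?b"
      using L2_inner_self_nonneg[of \<Omega> g] by simp
    \<comment> \<open>The value \<open>t = ?p / ?b\<close> minimises the quadratic.\<close>
    moreover have "0 \<le> ?a - ?p\<^sup>2 / ?b"
      using quad[of "?p / ?b"] False by (simp add: power2_eq_square)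
    ultimately show ?thesis
      by (simp add: field_simps)
  qed
  then have "\<bar>?p\<bar> \<le> sqrt (?a * ?b)"
    using real_sqrt_le_mono by fastforce
  then show ?thesis
    by (simp add: L2_norm_def real_sqrt_mult)
qed

text \<open>Carries identities tested on gradients of test functions over to their
  \<open>L\<^sup>2\<close> limits, hence to all of \<open>potential_fields\<close>.\<close>

lemma L2_inner_tendsto:
  assumes k: "k \<in> L2 \<Omega>" and p: "p \<in> L2 \<Omega>" and q: "\<And>n. q n \<in> L2 \<Omega>"
    and lim: "(\<lambda>n. L2_norm \<Omega> (\<lambda>x. p x - q n x)) \<longlonglongrightarrow> 0"
  shows "(\<lambda>n. L2_inner \<Omega> k (q n)) \<longlonglongrightarrow> L2_inner \<Omega> k p"
proof -
  have "(\<lambda>n. L2_inner \<Omega> k p - L2_inner \<Omega> k (q n)) \<longlonglongrightarrow> 0"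
  proof (rule Lim_null_comparison)
    show "\<forall>\<^sub>F n in sequentially. norm (L2_inner \<Omega> k p - L2_inner \<Omega> k (q n))
        \<le> L2_norm \<Omega> k * L2_norm \<Omega> (\<lambda>x. p x - q n x)"
      using L2_inner_Cauchy_Schwarz[OF k L2_diff[OF p q]] L2_inner_diff_right[OF p q k] by simp
    show "(\<lambda>n. L2_norm \<Omega> k * L2_norm \<Omega> (\<lambda>x. p x - q n x)) \<longlonglongrightarrow> 0"
      using tendsto_mult_right_zero[OF lim] .
  qed
  from tendsto_diff[OF tendsto_const[of "L2_inner \<Omega> k p"] this] show ?thesis
    by simp
qed

subsection \<open>Smooth bump functions\<close>

text \<open>By uniqueness of derivatives any exhibited \<open>D\<close> may stand in for
  \<open>frechet_derivative\<close>, so the inductions below can use the ordinary differentiation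
  rules.\<close>

lemma Ck_on_SucI:
  assumes "\<And>x. (f has_derivative D x) (at x)" "\<And>v. Ck_on n UNIV (\<lambda>x. D x v)"
  shows "Ck_on (Suc n) UNIV f"
proof -
  have "frechet_derivative f (at x) = D x" for x
    using frechet_derivative_at[OF assms(1)] by simp
  with assms show ?thesis
    by (auto simp: differentiable_def)
qed

lemma Ck_on_SucD: "Ck_on (Suc n) S f \<Longrightarrow> Ck_on n S f"
proof (induction n arbitrary: f)
  case 0
  then show ?case
    by (auto intro!: continuous_at_imp_continuous_on differentiable_imp_continuous_within)
qed auto

lemma Ck_on_Suc_has_derivative:
  "Ck_on (Suc n) UNIV f \<Longrightarrow> (f has_derivative frechet_derivative f (at x)) (at x)"
  by (simp add: frechet_derivative_works)

lemma Ck_on_const: "Ck_on n UNIV (\<lambda>x. c)"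
proof (induction n arbitrary: c)
  case (Suc n)
  show ?case
    by (rule Ck_on_SucI[where D = "\<lambda>x v. 0"]) (auto intro: Suc)
qed simp

lemma Ck_on_scaleR: "Ck_on n UNIV f \<Longrightarrow> Ck_on n UNIV (\<lambda>x. c *\<^sub>R f x)"
proof (induction n arbitrary: f)
  case (Suc n)
  show ?case
    by (rule Ck_on_SucI[OF has_derivative_scaleR_right[OF Ck_on_Suc_has_derivative[OF Suc.prems]]])
      (use Suc in auto)
qed (auto intro: continuous_intros)

lemma Ck_on_add: "Ck_on n UNIV f \<Longrightarrow> Ck_on n UNIV g \<Longrightarrow> Ck_on n UNIV (\<lambda>x. f x + g x)"
proof (induction n arbitrary: f g)
  case (Suc n)
  show ?case
    by (rule Ck_on_SucI[OF has_derivative_add[OF Ck_on_Suc_has_derivative[OF Suc.prems(1)]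
          Ck_on_Suc_has_derivative[OF Suc.prems(2)]]])
      (use Suc in auto)
qed (auto intro: continuous_intros)

text \<open>The product rule leaves an undifferentiated factor in each term, which is only needed in
  class \<open>n\<close>; \<open>Ck_on_SucD\<close> supplies this.\<close>

lemma Ck_on_mult:
  fixes f g :: "'a::real_normed_vector \<Rightarrow> real"
  shows "Ck_on n UNIV f \<Longrightarrow> Ck_on n UNIV g \<Longrightarrow> Ck_on n UNIV (\<lambda>x. f x * g x)"
proof (induction n arbitrary: f g)
  case (Suc n)
  show ?case
    by (rule Ck_on_SucI[OF has_derivative_mult[OF Ck_on_Suc_has_derivative[OF Suc.prems(1)]
          Ck_on_Suc_has_derivative[OF Suc.prems(2)]]])
      (intro Ck_on_add Suc.IH Ck_on_SucD[OF Suc.prems(1)] Ck_on_SucD[OF Suc.prems(2)];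
       use Suc.prems in simp)
qed (auto intro: continuous_intros)

lemma Ck_on_prod:
  fixes f :: "'i \<Rightarrow> 'a::real_normed_vector \<Rightarrow> real"
  shows "(\<And>i. i \<in> I \<Longrightarrow> Ck_on n UNIV (f i)) \<Longrightarrow> Ck_on n UNIV (\<lambda>x. \<Prod>i\<in>I. f i x)"
  by (induction I rule: infinite_finite_induct) (auto intro: Ck_on_const Ck_on_mult)

text \<open>The span of these functions over all \<open>k\<close> is closed under differentiation.\<close>

definition flat :: "real \<Rightarrow> nat \<Rightarrow> real \<Rightarrow> real" where
  "flat c k t = (if t \<le> 0 then 0 else exp (- c / t) / t ^ k)"

text \<open>The substitution \<open>s = c / t\<close> turns \<open>flat c k t\<close> into
  \<open>(1 / c) ^ k * (s ^ k / exp s)\<close> with \<open>s\<close> tending to infinity, where the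
  exponential beats every power.\<close>

lemma flat_tendsto_0:
  assumes "c > 0"
  shows "(flat c k \<longlongrightarrow> 0) (at_right 0)"
proof -
  have "((\<lambda>t. (1 / c) ^ k * ((c / t) ^ k / exp (c / t))) \<longlongrightarrow> (1 / c) ^ k * 0) (at_right 0)"
  proof (intro tendsto_mult tendsto_const filterlim_compose[OF tendsto_power_div_exp_0])
    show "filterlim (\<lambda>t. c / t) at_top (at_right 0)"
      using filterlim_tendsto_pos_mult_at_top[OF tendsto_const assms filterlim_inverse_at_top_right]
      by (simp add: divide_inverse)
  qed
  then have "((\<lambda>t. (1 / c) ^ k * ((c / t) ^ k / exp (c / t))) \<longlongrightarrow> 0) (at_right 0)"
    by simp
  moreover have "\<forall>\<^sub>F t in at_right 0. (1 / c) ^ k * ((c / t) ^ k / exp (c / t)) = flat c k t"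
    using assms by (auto simp: eventually_at_right_field flat_def exp_minus field_simps intro!: exI[of _ 1])
  ultimately show ?thesis
    by (rule Lim_transform_eventually)
qed

text \<open>One formula serves all \<open>t\<close>: for \<open>t > 0\<close> it is the quotient
  rule, and for \<open>t \<le> 0\<close> both of its terms vanish by definition.\<close>

lemma flat_has_field_derivative:
  assumes c: "c > 0"
  shows "(flat c k has_field_derivative c * flat c (k + 2) t - real k * flat c (k + 1) t) (at t)"
proof -
  consider "t < 0" | "t = 0" | "t > 0"
    by linarith
  then show ?thesis
  proof cases
    case 1
    have "(flat c k has_field_derivative 0) (at t)"
      by (rule has_field_derivative_transform_within_open[where S = "{..<0}" and f = "\<lambda>x. 0"])
        (use 1 in \<open>auto simp: flat_def\<close>)
    with 1 show ?thesis
      by (simp add: flat_def)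
  next
    case 2
    have "((\<lambda>h. flat c k h / h) \<longlongrightarrow> 0) (at 0)"
    proof (rule filterlim_split_at)
      have "\<forall>\<^sub>F h in at_left 0. 0 = flat c k h / h"
        by (auto simp: eventually_at_left_field flat_def intro!: exI[of _ "-1"])
      then show "((\<lambda>h. flat c k h / h) \<longlongrightarrow> 0) (at_left 0)"
        by (rule Lim_transform_eventually[OF tendsto_const])
      \<comment> \<open>Dividing by \<open>h\<close> merely raises the index, so the difference
        quotient at 0 falls under the same limit.\<close>
      have "\<forall>\<^sub>F h in at_right 0. flat c (k + 1) h = flat c k h / h"
        by (auto simp: eventually_at_right_field flat_def intro!: exI[of _ 1])
      then show "((\<lambda>h. flat c k h / h) \<longlongrightarrow> 0) (at_right 0)"
        by (rule Lim_transform_eventually[OF flat_tendsto_0[OF c]])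
    qed
    with 2 show ?thesis
      by (simp add: DERIV_def flat_def)
  next
    case 3
    have "((\<lambda>t. exp (- c / t)) has_field_derivative exp (- c / t) * (c / t\<^sup>2)) (at t)"
      using 3 by (auto intro!: derivative_eq_intros simp: power2_eq_square)
    from DERIV_quotient[OF this DERIV_pow[of k]]
    have "((\<lambda>t. exp (- c / t) / t ^ k) has_field_derivative
        (exp (- c / t) * (c / t\<^sup>2) * t ^ k - real k * t ^ (k - Suc 0) * exp (- c / t)) / (t ^ k) ^ Suc (Suc 0)) (at t)"
      using 3 by simp
    \<comment> \<open>Splitting on \<open>k\<close> resolves the truncated exponent
      \<open>k - Suc 0\<close>; for \<open>k = 0\<close> its coefficient is 0.\<close>
    moreover have "(exp (- c / t) * (c / t\<^sup>2) * t ^ k - real k * t ^ (k - Suc 0) * exp (- c / t)) / (t ^ k) ^ Suc (Suc 0)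
        = c * flat c (k + 2) t - real k * flat c (k + 1) t"
      using 3 by (cases k) (simp_all add: flat_def field_simps power2_eq_square)
    ultimately have "((\<lambda>t. exp (- c / t) / t ^ k) has_field_derivative
        c * flat c (k + 2) t - real k * flat c (k + 1) t) (at t)"
      by simp
    then show ?thesis
      by (rule has_field_derivative_transform_within_open[where S = "{0<..}"])
        (use 3 in \<open>auto simp: flat_def\<close>)
  qed
qed

text \<open>The same \<open>L\<close> is the derivative of \<open>l\<close> at every point, so the
  chain rule contributes only the constant factor \<open>L v\<close>. The induction is over all
  \<open>k\<close> at once because differentiation moves to the indices \<open>k + 1\<close> and
  \<open>k + 2\<close>.\<close>

lemma Ck_on_flat:
  assumes c: "c > 0" and l: "\<And>x. (l has_derivative L) (at x)"
  shows "Ck_on n UNIV (\<lambda>x. flat c k (l x))"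
proof (induction n arbitrary: k)
  case 0
  have "continuous_on UNIV (flat c k)"
    using DERIV_isCont[OF flat_has_field_derivative[OF c]] by (simp add: continuous_at_imp_continuous_on)
  moreover have "continuous_on UNIV l"
    using has_derivative_continuous[OF l] by (simp add: continuous_at_imp_continuous_on)
  ultimately show ?case
    using continuous_on_compose2[of UNIV "flat c k" UNIV l] by simp
next
  case (Suc n)
  have "((\<lambda>x. flat c k (l x)) has_derivative
      (\<lambda>v. (c * flat c (k + 2) (l x) - real k * flat c (k + 1) (l x)) * L v)) (at x)" for x
    by (rule has_derivative_compose[OF l flat_has_field_derivative[OF c, unfolded has_field_derivative_def]])
  moreover have "Ck_on n UNIV (\<lambda>x. (c * flat c (k + 2) (l x) - real k * flat c (k + 1) (l x)) * L v)" for v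
  proof -
    have "Ck_on n UNIV (\<lambda>x. c *\<^sub>R flat c (k + 2) (l x) + (- real k) *\<^sub>R flat c (k + 1) (l x))"
      by (intro Ck_on_add Ck_on_scaleR Suc.IH)
    then have "Ck_on n UNIV (\<lambda>x. c * flat c (k + 2) (l x) - real k * flat c (k + 1) (l x))"
      by (simp only: real_scaleR_def mult_minus_left add_uminus_conv_diff)
    then show ?thesis
      by (rule Ck_on_mult[OF _ Ck_on_const])
  qed
  ultimately show ?case
    by (rule Ck_on_SucI[where D = "\<lambda>x v. (c * flat c (k + 2) (l x) - real k * flat c (k + 1) (l x)) * L v"])
qed

text \<open>The arguments of \<open>flat\<close> are the signed distances of \<open>x $ i\<close> to
  the two faces of the box, so the product is nonzero exactly on \<open>box a b\<close>. Index 0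
  gives the profile \<open>exp (- c / t)\<close>, bounded by 1 for \<open>c > 0\<close>;
  \<open>c\<close> stays a parameter because letting it tend to 0 sharpens the bump to an
  indicator.\<close>

definition bump :: "real \<Rightarrow> real^'d \<Rightarrow> real^'d \<Rightarrow> real^'d \<Rightarrow> real" where
  "bump c a b x = (\<Prod>i\<in>UNIV. flat c 0 (x $ i - a $ i) * flat c 0 (b $ i - x $ i))"

lemma flat_0_bounds: "c > 0 \<Longrightarrow> 0 \<le> flat c 0 t \<and> flat c 0 t \<le> 1"
  by (simp add: flat_def)

lemma bump_bounds:
  assumes "c > 0"
  shows "0 \<le> bump c a b x \<and> bump c a b x \<le> 1"
proof -
  have "0 \<le> flat c 0 s * flat c 0 t \<and> flat c 0 s * flat c 0 t \<le> 1" for s t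
    using flat_0_bounds[OF assms] by (simp add: mult_le_one)
  then show ?thesis
    by (simp add: bump_def prod_nonneg prod_le_1)
qed

lemma bump_eq_0:
  assumes "x \<notin> box a b"
  shows "bump c a b x = 0"
proof -
  obtain i where "x $ i \<le> a $ i \<or> b $ i \<le> x $ i"
    using assms by (auto simp: mem_box_cart not_less)
  then have "flat c 0 (x $ i - a $ i) * flat c 0 (b $ i - x $ i) = 0"
    by (auto simp: flat_def)
  then show ?thesis
    unfolding bump_def by (intro prod_zero) auto
qed

text \<open>The compact set witnessing the support is \<open>cbox a b\<close>, which is why the
  closed box has to lie in \<Omega>.\<close>

lemma bump_test_function:
  fixes a b :: "real^'d"
  assumes "c > 0" "cbox a b \<subseteq> \<Omega>"
  shows "bump c a b \<in> test_functions \<Omega>"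
proof -
  have "Ck_on n UNIV (bump c a b)" for n
    unfolding bump_def
  proof (rule Ck_on_prod)
    fix i :: 'd
    have nth: "((\<lambda>x. x $ i) has_derivative (\<lambda>v. v $ i)) (at x)" for x :: "real^'d"
      by (rule bounded_linear_imp_has_derivative[OF bounded_linear_vec_nth])
    have "((\<lambda>x. x $ i - a $ i) has_derivative (\<lambda>v. v $ i)) (at x)" for x
      using has_derivative_diff[OF nth has_derivative_const[of "a $ i"]] by simp
    moreover have "((\<lambda>x. b $ i - x $ i) has_derivative (\<lambda>v. - (v $ i))) (at x)" for x
      using has_derivative_diff[OF has_derivative_const[of "b $ i"] nth] by simp
    ultimately show "Ck_on n UNIV (\<lambda>x. flat c 0 (x $ i - a $ i) * flat c 0 (b $ i - x $ i))"
      by (intro Ck_on_mult Ck_on_flat[OF assms(1)])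
  qed
  moreover have "\<forall>x. x \<notin> cbox a b \<longrightarrow> bump c a b x = 0"
    using bump_eq_0[of _ a b c] box_subset_cbox[of a b] by auto
  ultimately show ?thesis
    unfolding test_functions_def using assms(2) by (intro CollectI conjI exI[of _ "cbox a b"]) auto
qed

text \<open>Inside the box all distances \<open>t\<close> to the faces are positive and
  \<open>exp (- c / t)\<close> tends to 1 as \<open>c\<close> tends to 0; outside, every bump is 0.
  \<open>Suc n\<close> keeps \<open>c\<close> positive from the start.\<close>

lemma bump_tendsto_indicator:
  "(\<lambda>n. bump (1 / real (Suc n)) a b x) \<longlonglongrightarrow> indicator (box a b) x"
proof (cases "x \<in> box a b")
  case True
  have flat: "(\<lambda>n. flat (1 / real (Suc n)) 0 t) \<longlonglongrightarrow> 1" if "t > 0" for t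
  proof -
    have "(\<lambda>n. exp (- (1 / real (Suc n)) / t)) \<longlonglongrightarrow> exp (- 0 / t)"
      using LIMSEQ_inverse_real_of_nat that
      by (intro tendsto_exp tendsto_divide tendsto_minus tendsto_const) (auto simp: inverse_eq_divide)
    with that show ?thesis
      by (simp add: flat_def del: of_nat_Suc)
  qed
  have "(\<lambda>n. bump (1 / real (Suc n)) a b x) \<longlonglongrightarrow> (\<Prod>i\<in>(UNIV::'a set). 1 * 1)"
    unfolding bump_def
  proof (rule tendsto_prod)
    fix i :: 'a
    have "a $ i < x $ i" "x $ i < b $ i"
      using True by (auto simp: mem_box_cart)
    then show "(\<lambda>n. flat (1 / real (Suc n)) 0 (x $ i - a $ i) * flat (1 / real (Suc n)) 0 (b $ i - x $ i))
        \<longlonglongrightarrow> 1 * 1"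
      by (intro tendsto_mult flat) simp_all
  qed
  with True show ?thesis
    by (simp only: indicator_simps mult_1 prod.neutral_const)
qed (simp add: bump_eq_0)

subsection \<open>The fundamental lemma of the calculus of variations\<close>

text \<open>Open boxes are stable under intersection and generate the Borel sets, so a Dynkin
  induction extends the vanishing of the integral to all Borel sets. An integrable function whose
  integrals over all measurable sets agree with those of 0 is 0 almost everywhere.\<close>

lemma AE_eq_0_if_box_integrals_eq_0:
  fixes g :: "'a::euclidean_space \<Rightarrow> real"
  assumes g: "integrable lebesgue g"
    and box: "\<And>c d. (\<integral>x. indicator (box c d) x * g x \<partial>lebesgue) = 0"
  shows "AE x in lebesgue. g x = 0"
proof -
  have int: "integrable lebesgue (\<lambda>x. indicator A x * g x)" if "A \<in> sets lebesgue" for A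
    using integrable_mult_indicator[OF that g] by simp
  \<comment> \<open>The complement step of the induction subtracts from the integral over the whole
    space; that integral vanishes by exhaustion with growing boxes.\<close>
  have UNIV: "(\<integral>x. g x \<partial>lebesgue) = 0"
  proof -
    let ?B = "\<lambda>n::nat. box (- (real n *\<^sub>R One)) (real n *\<^sub>R One) :: 'a set"
    have "(\<lambda>n. \<integral>x. indicator (?B n) x * g x \<partial>lebesgue) \<longlonglongrightarrow> (\<integral>x. g x \<partial>lebesgue)"
    proof (rule integral_dominated_convergence[where w = "\<lambda>x. norm (g x)"])
      show "AE x in lebesgue. (\<lambda>n. indicator (?B n) x * g x) \<longlonglongrightarrow> g x"
      proof (rule AE_I2)
        fix x :: 'a
        obtain n0 where n0: "\<And>n. n \<ge> n0 \<Longrightarrow> x \<in> ?B n"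
        proof -
          obtain n0 where n0: "norm x < real n0"
            using reals_Archimedean2 by blast
          have "x \<in> ?B n" if "n \<ge> n0" for n
          proof -
            have "\<bar>x \<bullet> i\<bar> < real n" if "i \<in> Basis" for i
              using Basis_le_norm[OF that, of x] n0 \<open>n \<ge> n0\<close> by simp
            then show ?thesis
              by (auto simp: box_def abs_less_iff minus_less_iff)
          qed
          then show ?thesis
            using that by blast
        qed
        have "\<forall>\<^sub>F n in sequentially. g x = indicator (?B n) x * g x"
          using n0 by (auto simp: eventually_sequentially intro!: exI[of _ n0])
        then show "(\<lambda>n. indicator (?B n) x * g x) \<longlonglongrightarrow> g x"
          by (rule Lim_transform_eventually[OF tendsto_const])
      qed
      show "AE x in lebesgue. norm (indicator (?B n) x * g x) \<le> norm (g x)" for n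
        by (auto simp: indicator_def)
      show "(\<lambda>x. indicator (?B n) x * g x) \<in> borel_measurable lebesgue" for n
        using int[of "?B n"] by auto
    qed (use g in auto)
    then show ?thesis
      using LIMSEQ_unique[OF tendsto_const[of 0]] by (simp add: box)
  qed
  have borel: "(\<integral>x. indicator A x * g x \<partial>lebesgue) = 0" if "A \<in> sets borel" for A
  proof -
    let ?G = "range (\<lambda>(a, b). box a b :: 'a set)"
    have "Int_stable ?G"
      by (auto simp: Int_stable_def box_Int_box)
    moreover have "?G \<subseteq> Pow UNIV"
      by simp
    moreover have "A \<in> sigma_sets UNIV ?G"
      using that by (simp add: borel_eq_box)
    moreover have sigma: "sigma_sets UNIV ?G = sets borel"
      by (simp add: borel_eq_box)
    ultimately show ?thesis
    proof (induction rule: sigma_sets_induct_disjoint)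
      case (basic A)
      then show ?case
        by (auto simp: box)
    next
      case (compl A)
      then have "A \<in> sets lebesgue"
        by (simp add: sigma)
      from int[OF this] have "(\<integral>x. g x - indicator A x * g x \<partial>lebesgue) = 0"
        using g by (simp add: UNIV compl)
      moreover have "indicator (UNIV - A) x * g x = g x - indicator A x * g x" for x
        by (simp add: indicator_def)
      ultimately show ?case
        by simp
    next
      case (union A)
      then have A: "A i \<in> sets lebesgue" for i
        by (auto simp: sigma image_subset_iff)
      then have "(LINT x:(\<Union>i. A i)|lebesgue. g x) = (\<Sum>i. (LINT x:(A i)|lebesgue. g x))"
        using union(1) int[of "\<Union>i. A i"]
        by (intro lebesgue_integral_countable_add) (auto simp: set_integrable_def disjoint_family_on_def)
      then show ?case
        by (simp add: set_lebesgue_integral_def union)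
    qed simp
  qed
  show ?thesis
  proof (rule density_unique_real[OF g])
    fix A :: "'a set" assume A: "A \<in> sets lebesgue"
    \<comment> \<open>A Lebesgue set is a Borel set up to a negligible set, which the integral does
      not see.\<close>
    obtain B N where B: "B \<in> sets borel" and N: "negligible N" and BN: "B \<union> N = A"
      using sets_lebesgue_almost_borel[OF A] by blast
    have "(\<integral>x. indicator A x * g x \<partial>lebesgue) = (\<integral>x. indicator B x * g x \<partial>lebesgue)"
    proof (rule integral_cong_AE)
      have "AE x in lebesgue. x \<notin> N"
        using N by (simp add: negligible_iff_null_sets AE_not_in)
      then show "AE x in lebesgue. indicator A x * g x = indicator B x * g x"
        using BN by (auto simp: indicator_def)
      show "(\<lambda>x. indicator A x * g x) \<in> borel_measurable lebesgue"
        "(\<lambda>x. indicator B x * g x) \<in> borel_measurable lebesgue"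
        using int[OF A] int[of B] B by auto
    qed
    with borel[OF B] show "set_lebesgue_integral lebesgue A g = (LINT x:A|lebesgue. 0)"
      by (simp add: set_lebesgue_integral_def)
  qed simp
qed

text \<open>Bumps converge to indicators of boxes, so \<open>f\<close> has integral 0 over every
  open box whose closed box lies in \<Omega>. This determines \<open>f\<close> on each such box, and
  countably many of them cover \<Omega>.\<close>

lemma fundamental_lemma_variations:
  fixes f :: "real^'d \<Rightarrow> real"
  assumes \<Omega>: "open \<Omega>" and f: "f \<in> L2 \<Omega>"
    and test: "\<And>\<phi>. \<phi> \<in> test_functions \<Omega> \<Longrightarrow> (\<integral>x. f x * \<phi> x \<partial>lebesgue_on \<Omega>) = 0"
  shows "AE x in lebesgue_on \<Omega>. f x = 0"
proof -
  have \<Omega>_sets: "\<Omega> \<in> sets lebesgue"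
    using \<Omega> by auto
  have ind: "(\<lambda>x. indicator (cbox a b) x :: real) \<in> L2 \<Omega>" for a b
    by (rule L2_bounded_support[OF \<Omega>_sets, where K = "cbox a b" and M = 1]) (auto simp: indicator_def)
  have int: "integrable lebesgue (\<lambda>x. indicator \<Omega> x * (f x * indicator (cbox a b) x))" for a b
    using integrable_inner_L2[OF f ind] \<Omega>_sets by (simp add: integrable_restrict_space)
  have meas: "(\<lambda>x. indicator \<Omega> x * f x) \<in> borel_measurable lebesgue"
    using L2_measurable[OF f] \<Omega>_sets by (simp add: borel_measurable_restrict_space_iff)
  have box0: "(\<integral>x. f x * indicator (box a b) x \<partial>lebesgue_on \<Omega>) = 0" if ab: "cbox a b \<subseteq> \<Omega>" for a b
  proof -
    let ?\<phi> = "\<lambda>n. bump (1 / real (Suc n)) a b"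
    have \<phi>: "?\<phi> n \<in> test_functions \<Omega>" for n
      by (rule bump_test_function[OF _ ab]) simp
    have [measurable]: "f \<in> borel_measurable (lebesgue_on \<Omega>)"
      by (rule L2_measurable[OF f])
    have cont: "continuous_on UNIV (?\<phi> n)" for n
    proof -
      have "Ck_on 0 UNIV (?\<phi> n)"
        using \<phi>[of n] unfolding test_functions_def by blast
      then show ?thesis
        by simp
    qed
    \<comment> \<open>The bumps are bounded by 1 and vanish off the box, and \<open>f\<close> times
      the indicator of \<open>cbox a b\<close> is integrable as a product of two square integrable
      functions.\<close>
    have "(\<lambda>n. \<integral>x. f x * ?\<phi> n x \<partial>lebesgue_on \<Omega>) \<longlonglongrightarrow> (\<integral>x. f x * indicator (box a b) x \<partial>lebesgue_on \<Omega>)"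
    proof (rule integral_dominated_convergence[where w = "\<lambda>x. \<bar>f x * indicator (cbox a b) x\<bar>"])
      show "integrable (lebesgue_on \<Omega>) (\<lambda>x. \<bar>f x * indicator (cbox a b) x\<bar>)"
        using integrable_inner_L2[OF f ind] by simp
      show "AE x in lebesgue_on \<Omega>. (\<lambda>n. f x * ?\<phi> n x) \<longlonglongrightarrow> f x * indicator (box a b) x"
        by (intro AE_I2 tendsto_mult tendsto_const bump_tendsto_indicator)
      show "AE x in lebesgue_on \<Omega>. norm (f x * ?\<phi> n x) \<le> \<bar>f x * indicator (cbox a b) x\<bar>" for n
      proof (rule AE_I2)
        fix x
        have "\<bar>?\<phi> n x\<bar> \<le> indicator (cbox a b) x"
          using bump_bounds[of "1 / real (Suc n)" a b x] bump_eq_0[of x a b] subsetD[OF box_subset_cbox, of x a b]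
          by (cases "x \<in> cbox a b"; cases "x \<in> box a b") (simp_all del: of_nat_Suc)
        then show "norm (f x * ?\<phi> n x) \<le> \<bar>f x * indicator (cbox a b) x\<bar>"
          by (simp add: abs_mult mult_left_mono)
      qed
      have [measurable]: "?\<phi> n \<in> borel_measurable (lebesgue_on \<Omega>)" for n
        using borel_measurable_continuous_onI[OF cont]
        by (auto intro!: measurable_restrict_space1 measurable_completion)
      show "(\<lambda>x. f x * ?\<phi> n x) \<in> borel_measurable (lebesgue_on \<Omega>)" for n
        by measurable
      have "(\<lambda>x. indicator (box a b) x :: real) \<in> borel_measurable (lebesgue_on \<Omega>)"
        by (auto intro!: measurable_restrict_space1 measurable_completion)
      then show "(\<lambda>x. f x * indicator (box a b) x) \<in> borel_measurable (lebesgue_on \<Omega>)"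
        by simp
    qed
    then show ?thesis
      unfolding test[OF \<phi>] LIMSEQ_const_iff by (rule sym)
  qed
  have cbox: "AE x in lebesgue. x \<in> cbox a b \<longrightarrow> f x = 0" if ab: "cbox a b \<subseteq> \<Omega>" for a b
  proof -
    \<comment> \<open>The cut-off makes \<open>?g\<close> integrable on the whole space;
      \<open>f\<close> is only known to be square integrable on \<Omega>.\<close>
    let ?g = "\<lambda>x. indicator (box a b) x * f x"
    have g: "?g = (\<lambda>x. indicator (box a b) x * (indicator \<Omega> x * (f x * indicator (cbox a b) x)))"
      using ab box_subset_cbox[of a b] by (auto simp: indicator_def fun_eq_iff)
    have "integrable lebesgue ?g"
      unfolding g using integrable_mult_indicator[OF _ int, of "box a b" a b] by simp
    moreover have "(\<integral>x. indicator (box c d) x * ?g x \<partial>lebesgue) = 0" for c d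
    proof -
      obtain p q where pq: "box a b \<inter> box c d = box p q"
        by (simp add: box_Int_box)
      \<comment> \<open>A nonempty \<open>box p q\<close> has closure \<open>cbox p q\<close>, which
        stays inside \<open>cbox a b\<close>. An empty one says nothing about
        \<open>cbox p q\<close>, but then the integral is trivially 0.\<close>
      have "cbox p q \<subseteq> \<Omega> \<or> box p q = {}"
      proof (cases "box p q = {}")
        case False
        have "box p q \<subseteq> cbox a b"
          using pq box_subset_cbox[of a b] by auto
        then have "closure (box p q) \<subseteq> cbox a b"
          by (rule closure_minimal) (rule closed_cbox)
        with False ab show ?thesis
          by (simp add: closure_box)
      qed simp
      then have "(\<integral>x. f x * indicator (box p q) x \<partial>lebesgue_on \<Omega>) = 0"
        using box0 by auto
      moreover have eq: "(\<lambda>x. indicator (box c d) x * ?g x) =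
          (\<lambda>x. indicator \<Omega> x * (f x * indicator (box p q) x))"
        unfolding pq[symmetric] using ab box_subset_cbox[of a b] by (auto simp: indicator_def fun_eq_iff)
      ultimately show ?thesis
        unfolding eq using \<Omega>_sets by (simp add: integral_restrict_space)
    qed
    ultimately have "AE x in lebesgue. ?g x = 0"
      by (rule AE_eq_0_if_box_integrals_eq_0)
    \<comment> \<open>The faces of the box form a null set, so vanishing on the open box gives the
      closed one.\<close>
    moreover have "AE x in lebesgue. x \<notin> cbox a b - box a b"
      by (rule AE_not_in) (use negligible_frontier_interval in \<open>simp only: negligible_iff_null_sets\<close>)
    ultimately show ?thesis
      by eventually_elim (auto simp: indicator_def split: if_splits)
  qed
  obtain \<D> where \<D>: "countable \<D>" "\<D> \<subseteq> Pow \<Omega>" "\<And>X. X \<in> \<D> \<Longrightarrow> \<exists>a b. X = cbox a b" "\<Union>\<D> = \<Omega>"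
    using open_countable_Union_open_cbox[OF \<Omega>] by blast
  have "AE x in lebesgue. \<forall>X\<in>\<D>. x \<in> X \<longrightarrow> f x = 0"
    using \<D>(1)
  proof (rule AE_ball_countable'[rotated])
    fix X assume "X \<in> \<D>"
    then show "AE x in lebesgue. x \<in> X \<longrightarrow> f x = 0"
      using \<D>(2,3) cbox by blast
  qed
  then have "AE x in lebesgue. x \<in> \<Omega> \<longrightarrow> f x = 0"
    using \<D>(4) by (auto elim: eventually_mono)
  then show ?thesis
    using \<Omega>_sets by (simp add: AE_restrict_space_iff)
qed

subsection \<open>Integration by parts and weak gradients\<close>

lemma has_real_derivative_along_line:
  fixes F :: "'a::real_normed_vector \<Rightarrow> real"
  assumes "(F has_derivative D) (at (x + t *\<^sub>R e))"
  shows "((\<lambda>s. F (x + s *\<^sub>R e)) has_real_derivative D e) (at t)"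
proof -
  have "((\<lambda>s. x + s *\<^sub>R e) has_derivative (\<lambda>s. s *\<^sub>R e)) (at t)"
    by (auto intro!: derivative_eq_intros)
  from has_derivative_compose[OF this assms]
  have "((\<lambda>s. F (x + s *\<^sub>R e)) has_derivative (\<lambda>s. D (s *\<^sub>R e))) (at t)" .
  moreover have "D (s *\<^sub>R e) = D e * s" for s
    using linear_scale[OF has_derivative_linear[OF assms]] by simp
  ultimately show ?thesis
    by (simp add: has_field_derivative_def)
qed

text \<open>By translation invariance all difference quotients have integral zero.\<close>

lemma integral_directional_derivative_eq_0:
  fixes F :: "'a::euclidean_space \<Rightarrow> real"
  assumes F: "\<And>x. (F has_derivative D x) (at x)"
    and cont: "continuous_on UNIV (\<lambda>x. D x e)"
    and K: "compact K" "\<And>x. x \<notin> K \<Longrightarrow> F x = 0"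
  shows "(\<integral>x. D x e \<partial>lborel) = 0"
proof -
  define h where "h n = 1 / real (Suc n)" for n
  have h: "0 < h n" "h n \<le> 1" for n
    by (simp_all add: h_def)
  define s where "s n x = (F (x + h n *\<^sub>R e) - F x) / h n" for n x
  have F_cont: "continuous_on UNIV F"
    using has_derivative_continuous[OF F] by (simp add: continuous_at_imp_continuous_on)
  then have F_meas [measurable]: "F \<in> borel_measurable borel"
    by (rule borel_measurable_continuous_onI)
  have F_int: "integrable lborel F"
  proof -
    have "integrable lborel (\<lambda>x. indicator K x *\<^sub>R F x)"
      by (rule borel_integrable_compact[OF K(1) continuous_on_subset[OF F_cont]]) simp
    moreover have "(\<lambda>x. indicator K x *\<^sub>R F x) = F"
      using K(2) by (auto simp: indicator_def fun_eq_iff)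
    ultimately show ?thesis
      by simp
  qed
  have D0: "D x e = 0" if "x \<notin> K" for x
  proof -
    have "(F has_derivative (\<lambda>_. 0)) (at x)"
    proof (rule has_derivative_transform_within_open[where s = "- K" and f = "\<lambda>_. 0"])
      show "open (- K)"
        using K(1) compact_imp_closed by blast
    qed (use that K(2) in auto)
    from has_derivative_unique[OF this F] show ?thesis
      by metis
  qed
  obtain M where M: "M > 0" "\<And>x. \<bar>D x e\<bar> \<le> M"
  proof -
    have "bounded ((\<lambda>x. D x e) ` K)"
      by (intro compact_imp_bounded compact_continuous_image K continuous_on_subset[OF cont]) simp
    then obtain M where "M > 0" "\<And>x. x \<in> K \<Longrightarrow> \<bar>D x e\<bar> \<le> M"
      by (auto simp: bounded_pos)
    then have "\<bar>D x e\<bar> \<le> M" for x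
      using D0[of x] by (cases "x \<in> K") auto
    with \<open>M > 0\<close> show ?thesis
      using that by blast
  qed
  obtain R where R: "\<And>x. x \<in> K \<Longrightarrow> norm x \<le> R"
    using compact_imp_bounded[OF K(1)] by (auto simp: bounded_iff)
  have "(\<lambda>n. \<integral>x. s n x \<partial>lborel) \<longlonglongrightarrow> (\<integral>x. D x e \<partial>lborel)"
  proof (rule integral_dominated_convergence[where w = "\<lambda>x. M * indicator (cball 0 (R + norm e)) x"])
    show "(\<lambda>x. D x e) \<in> borel_measurable lborel"
      using borel_measurable_continuous_onI[OF cont] by simp
    show "s n \<in> borel_measurable lborel" for n
      unfolding s_def by measurable
    show "integrable lborel (\<lambda>x. M * indicator (cball 0 (R + norm e)) x)"
      using emeasure_bounded_finite[OF bounded_cball]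
      by (intro integrable_mult_right integrable_real_indicator) auto
    show "AE x in lborel. (\<lambda>n. s n x) \<longlonglongrightarrow> D x e"
    proof (rule AE_I2)
      fix x
      have "((\<lambda>t. F (x + t *\<^sub>R e)) has_real_derivative D x e) (at 0)"
        by (rule has_real_derivative_along_line) (simp add: F)
      then have "((\<lambda>t. (F (x + t *\<^sub>R e) - F x) / t) \<longlongrightarrow> D x e) (at 0)"
        by (simp add: DERIV_def)
      moreover have "filterlim h (at 0) sequentially"
        unfolding h_def
        using LIMSEQ_inverse_real_of_nat by (intro filterlim_atI) (auto simp: inverse_eq_divide)
      ultimately show "(\<lambda>n. s n x) \<longlonglongrightarrow> D x e"
        unfolding s_def by (rule filterlim_compose)
    qed
    \<comment> \<open>By the mean value theorem every quotient is a value of the derivative, hence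
      bounded by \<open>M\<close>. It can be nonzero only if \<open>x\<close> or
      \<open>x + h n *\<^sub>R e\<close> lies in \<open>K\<close>; since \<open>h n \<le> 1\<close>,
      this forces \<open>norm x \<le> R + norm e\<close> for all \<open>n\<close> alike.\<close>
    show "AE x in lborel. norm (s n x) \<le> M * indicator (cball 0 (R + norm e)) x" for n
    proof (rule AE_I2)
      fix x
      show "norm (s n x) \<le> M * indicator (cball 0 (R + norm e)) x"
      proof (cases "x \<in> cball 0 (R + norm e)")
        case True
        obtain z where "F (x + h n *\<^sub>R e) - F (x + 0 *\<^sub>R e) = (h n - 0) * D (x + z *\<^sub>R e) e"
          using MVT2[OF h(1)[of n], of "\<lambda>t. F (x + t *\<^sub>R e)" "\<lambda>t. D (x + t *\<^sub>R e) e"]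
            has_real_derivative_along_line[OF F] by blast
        then have "s n x = D (x + z *\<^sub>R e) e"
          using h(1)[of n] by (simp add: s_def)
        with True M(2) show ?thesis
          by simp
      next
        case False
        then have "R + norm e < norm x"
          by simp
        moreover have "norm x \<le> norm (x + h n *\<^sub>R e) + h n * norm e"
          using norm_triangle_ineq4[of "x + h n *\<^sub>R e" "h n *\<^sub>R e"] h(1)[of n] by simp
        moreover have "h n * norm e \<le> norm e"
          using h[of n] by (simp add: mult_left_le_one_le)
        moreover have "0 \<le> norm e"
          by simp
        ultimately have "x \<notin> K" "x + h n *\<^sub>R e \<notin> K"
          using R[of x] R[of "x + h n *\<^sub>R e"] by linarith+
        with False K(2) show ?thesis
          by (simp add: s_def)
      qed
    qed
  qed
  moreover have "(\<integral>x. s n x \<partial>lborel) = 0" for n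
  proof -
    let ?c = "h n *\<^sub>R e"
    have "integrable lborel (\<lambda>x. F (?c + x))" and "(\<integral>x. F (?c + x) \<partial>lborel) = (\<integral>x. F x \<partial>lborel)"
      using integrable_distr_eq[of "(+) ?c" lborel borel F] integral_distr[of "(+) ?c" lborel borel F] F_int
      by (simp_all add: lborel_distr_plus)
    with F_int show ?thesis
      by (simp add: s_def add.commute)
  qed
  ultimately show ?thesis
    using LIMSEQ_unique[OF tendsto_const[of 0]] by simp
qed

section \<open>Regularity, support and integrability of test functions\<close>

lemma test_function_has_derivative:
  "\<phi> \<in> test_functions \<Omega> \<Longrightarrow> (\<phi> has_derivative frechet_derivative \<phi> (at x)) (at x)"
  unfolding test_functions_def by (intro Ck_on_Suc_has_derivative) auto

lemma test_function_Ck: "\<phi> \<in> test_functions \<Omega> \<Longrightarrow> Ck_on n UNIV \<phi>"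
  by (simp add: test_functions_def)

lemma test_function_continuous: "\<phi> \<in> test_functions \<Omega> \<Longrightarrow> continuous_on UNIV \<phi>"
  using test_function_Ck[of \<phi> \<Omega> 0] by simp

lemma test_function_derivative_continuous:
  "\<phi> \<in> test_functions \<Omega> \<Longrightarrow> continuous_on UNIV (\<lambda>x. frechet_derivative \<phi> (at x) v)"
  using test_function_Ck[of \<phi> \<Omega> 1] by simp

lemma test_function_support:
  assumes \<phi>: "\<phi> \<in> test_functions \<Omega>"
  obtains K where "compact K" "K \<subseteq> \<Omega>" "\<And>x. x \<notin> K \<Longrightarrow> \<phi> x = 0"
    "\<And>x v. x \<notin> K \<Longrightarrow> frechet_derivative \<phi> (at x) v = 0"
proof -
  obtain K where K: "compact K" "K \<subseteq> \<Omega>" "\<And>x. x \<notin> K \<Longrightarrow> \<phi> x = 0"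
    using \<phi> unfolding test_functions_def by blast
  have "frechet_derivative \<phi> (at x) v = 0" if "x \<notin> K" for x v
  proof -
    have "(\<phi> has_derivative (\<lambda>_. 0)) (at x)"
    proof (rule has_derivative_transform_within_open[where s = "- K" and f = "\<lambda>_. 0"])
      show "open (- K)"
        using K(1) compact_imp_closed by blast
    qed (use that K(3) in auto)
    from has_derivative_unique[OF this test_function_has_derivative[OF \<phi>]] show ?thesis
      by metis
  qed
  with K that show ?thesis
    by blast
qed

lemma test_function_L2:
  fixes \<phi> :: "real^'d \<Rightarrow> 'b::euclidean_space"
  assumes "\<Omega> \<in> sets lebesgue" "\<phi> \<in> test_functions \<Omega>"
  shows "\<phi> \<in> L2 \<Omega>"
proof (rule test_function_support[OF assms(2)])
  fix K assume "compact K" "\<And>x. x \<notin> K \<Longrightarrow> \<phi> x = 0"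
  then show ?thesis
    by (rule L2_continuous_support[OF assms(1) test_function_continuous[OF assms(2)]])
qed

lemma test_function_derivative_L2:
  fixes \<phi> :: "real^'d \<Rightarrow> 'b::euclidean_space"
  assumes "\<Omega> \<in> sets lebesgue" "\<phi> \<in> test_functions \<Omega>"
  shows "(\<lambda>x. frechet_derivative \<phi> (at x) v) \<in> L2 \<Omega>"
proof (rule test_function_support[OF assms(2)])
  fix K assume "compact K" "\<And>x v. x \<notin> K \<Longrightarrow> frechet_derivative \<phi> (at x) v = 0"
  then show ?thesis
    by (rule L2_continuous_support[OF assms(1) test_function_derivative_continuous[OF assms(2)]])
qed

lemma jacobian_nth: "jacobian f F $ i $ j = frechet_derivative f F (axis j 1) $ i"
  by (simp add: jacobian_def matrix_def)

lemma jacobian_L2: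
  fixes \<phi> :: "real^'d \<Rightarrow> real^'m"
  assumes "\<Omega> \<in> sets lebesgue" "\<phi> \<in> test_functions \<Omega>"
  shows "(\<lambda>x. jacobian \<phi> (at x)) \<in> L2 \<Omega>"
proof -
  have "(\<lambda>x. frechet_derivative \<phi> (at x) (axis j 1) $ i) \<in> L2 \<Omega>" for i j
    using test_function_derivative_L2[OF assms, of "axis j 1"] by (simp add: L2_vec_iff)
  then show ?thesis
    by (simp add: L2_vec_iff jacobian_nth)
qed

lemma integrable_mult_L2:
  fixes f g :: "real^'d \<Rightarrow> real"
  assumes "f \<in> L2 \<Omega>" "g \<in> L2 \<Omega>"
  shows "integrable (lebesgue_on \<Omega>) (\<lambda>x. f x * g x)"
  using integrable_inner_L2[OF assms] by simp

text \<open>The field \<open>?D\<close> is the derivative of the product of \<open>g x $ i\<close>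
  and \<open>\<phi> x\<close>, which has compact support in \<Omega>, so its directional derivative
  integrates to 0; separating the two terms is integration by parts.\<close>

lemma is_weak_gradient_jacobian:
  assumes \<Omega>: "\<Omega> \<in> sets lebesgue" and g: "g \<in> test_functions \<Omega>"
  shows "is_weak_gradient \<Omega> g (\<lambda>x. jacobian g (at x))"
  unfolding is_weak_gradient_def
proof (intro conjI ballI allI)
  show "(\<lambda>x. jacobian g (at x)) \<in> L2 \<Omega>"
    by (rule jacobian_L2[OF \<Omega> g])
  fix \<phi> :: "real^'a \<Rightarrow> real" and i j
  assume \<phi>: "\<phi> \<in> test_functions \<Omega>"
  let ?e = "axis j 1 :: real^'a"
  let ?D = "\<lambda>x v. g x $ i * frechet_derivative \<phi> (at x) v + frechet_derivative g (at x) v $ i * \<phi> x"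
  have gi: "(\<lambda>x. g x $ i) \<in> L2 \<Omega>" "(\<lambda>x. frechet_derivative g (at x) ?e $ i) \<in> L2 \<Omega>"
    using test_function_L2[OF \<Omega> g] test_function_derivative_L2[OF \<Omega> g, of ?e]
    by (auto simp: L2_vec_iff)
  have int: "integrable (lebesgue_on \<Omega>) (\<lambda>x. g x $ i * frechet_derivative \<phi> (at x) ?e)"
    "integrable (lebesgue_on \<Omega>) (\<lambda>x. frechet_derivative g (at x) ?e $ i * \<phi> x)"
    by (intro integrable_mult_L2 gi test_function_L2[OF \<Omega> \<phi>] test_function_derivative_L2[OF \<Omega> \<phi>])+
  obtain K where K: "compact K" "K \<subseteq> \<Omega>" "\<And>x. x \<notin> K \<Longrightarrow> \<phi> x = 0"
    "\<And>x v. x \<notin> K \<Longrightarrow> frechet_derivative \<phi> (at x) v = 0"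
    using test_function_support[OF \<phi>] by blast
  have cont: "continuous_on UNIV (\<lambda>x. ?D x ?e)"
    by (intro continuous_intros test_function_continuous[OF g] test_function_continuous[OF \<phi>]
        test_function_derivative_continuous[OF g] test_function_derivative_continuous[OF \<phi>])
  have "(\<integral>x. ?D x ?e \<partial>lborel) = 0"
  proof (rule integral_directional_derivative_eq_0[where F = "\<lambda>x. g x $ i * \<phi> x"])
    fix x
    have "((\<lambda>x. g x $ i) has_derivative (\<lambda>v. frechet_derivative g (at x) v $ i)) (at x)"
      by (rule bounded_linear.has_derivative[OF bounded_linear_vec_nth test_function_has_derivative[OF g]])
    from has_derivative_mult[OF this test_function_has_derivative[OF \<phi>]]
    show "((\<lambda>x. g x $ i * \<phi> x) has_derivative ?D x) (at x)" .
  qed (use cont K in auto)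
  \<comment> \<open>The integrand is continuous and vanishes off a compact subset of \<Omega>, so
    neither the restriction to \<Omega> nor the completion of the measure changes the
    integral.\<close>
  moreover have "(\<integral>x. ?D x ?e \<partial>lborel) = (\<integral>x. ?D x ?e \<partial>lebesgue_on \<Omega>)"
  proof -
    have eq: "(\<lambda>x. indicator \<Omega> x *\<^sub>R ?D x ?e) = (\<lambda>x. ?D x ?e)"
    proof
      fix x
      show "indicator \<Omega> x *\<^sub>R ?D x ?e = ?D x ?e"
        using K(2) K(3,4)[of x] by (cases "x \<in> \<Omega>"; cases "x \<in> K") auto
    qed
    have "(\<integral>x. ?D x ?e \<partial>lebesgue_on \<Omega>) = (\<integral>x. indicator \<Omega> x *\<^sub>R ?D x ?e \<partial>lebesgue)"
      using \<Omega> by (intro integral_restrict_space) simp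
    also have "\<dots> = (\<integral>x. ?D x ?e \<partial>lborel)"
      unfolding eq by (intro integral_completion) (simp add: borel_measurable_continuous_onI[OF cont])
    finally show ?thesis
      by (rule sym)
  qed
  ultimately show "(\<integral>x. g x $ i * frechet_derivative \<phi> (at x) ?e \<partial>lebesgue_on \<Omega>)
      = - (\<integral>x. jacobian g (at x) $ i $ j * \<phi> x \<partial>lebesgue_on \<Omega>)"
    using int by (simp add: jacobian_nth)
qed

section \<open>Uniqueness and linearity of weak gradients\<close>

lemma is_weak_gradientD:
  "is_weak_gradient \<Omega> u G \<Longrightarrow> \<phi> \<in> test_functions \<Omega> \<Longrightarrow>
    (\<integral>x. u x $ i * frechet_derivative \<phi> (at x) (axis j 1) \<partial>lebesgue_on \<Omega>)
      = - (\<integral>x. G x $ i $ j * \<phi> x \<partial>lebesgue_on \<Omega>)"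
  unfolding is_weak_gradient_def by blast

text \<open>Both candidates have the same integrals against test functions, since these are
  expressed through \<open>u\<close> alone; the fundamental lemma then applies to each entry of the
  difference.\<close>

lemma is_weak_gradient_AE_unique:
  assumes \<Omega>: "open \<Omega>" and G: "is_weak_gradient \<Omega> u G" "is_weak_gradient \<Omega> u G'"
  shows "AE x in lebesgue_on \<Omega>. G x = G' x"
proof -
  have L2: "(\<lambda>x. G x $ i $ j) \<in> L2 \<Omega>" "(\<lambda>x. G' x $ i $ j) \<in> L2 \<Omega>" for i j
    using G by (auto simp: is_weak_gradient_def L2_vec_iff)
  have "AE x in lebesgue_on \<Omega>. G x $ i $ j - G' x $ i $ j = 0" for i j
  proof (rule fundamental_lemma_variations[OF \<Omega> L2_diff[OF L2]])
    fix \<phi> :: "real^'a \<Rightarrow> real"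
    assume \<phi>: "\<phi> \<in> test_functions \<Omega>"
    have "\<phi> \<in> L2 \<Omega>"
      using \<Omega> \<phi> by (intro test_function_L2) auto
    then have "integrable (lebesgue_on \<Omega>) (\<lambda>x. G x $ i $ j * \<phi> x)"
      "integrable (lebesgue_on \<Omega>) (\<lambda>x. G' x $ i $ j * \<phi> x)"
      by (simp_all add: integrable_mult_L2 L2)
    moreover have "(\<integral>x. G x $ i $ j * \<phi> x \<partial>lebesgue_on \<Omega>) = (\<integral>x. G' x $ i $ j * \<phi> x \<partial>lebesgue_on \<Omega>)"
      using is_weak_gradientD[OF G(1) \<phi>, of i j] is_weak_gradientD[OF G(2) \<phi>, of i j] by simp
    ultimately show "(\<integral>x. (G x $ i $ j - G' x $ i $ j) * \<phi> x \<partial>lebesgue_on \<Omega>) = 0"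
      by (simp add: left_diff_distrib)
  qed
  then have "AE x in lebesgue_on \<Omega>. \<forall>i\<in>UNIV. \<forall>j\<in>UNIV. G x $ i $ j - G' x $ i $ j = 0"
    by (intro AE_finite_allI) auto
  then show ?thesis
    by eventually_elim (simp add: vec_eq_iff)
qed

lemma is_weak_gradient_weak_gradient: "u \<in> H1 \<Omega> \<Longrightarrow> is_weak_gradient \<Omega> u (weak_gradient \<Omega> u)"
proof -
  assume "u \<in> H1 \<Omega>"
  then obtain G where "is_weak_gradient \<Omega> u G"
    by (auto simp: H1_def)
  then show ?thesis
    unfolding weak_gradient_def by (rule someI[of "is_weak_gradient \<Omega> u"])
qed

lemma weak_gradient_L2: "u \<in> H1 \<Omega> \<Longrightarrow> weak_gradient \<Omega> u \<in> L2 \<Omega>"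
  using is_weak_gradient_weak_gradient by (auto simp: is_weak_gradient_def)

lemma weak_gradient_AE_eq:
  assumes "open \<Omega>" "u \<in> L2 \<Omega>" "is_weak_gradient \<Omega> u G"
  shows "AE x in lebesgue_on \<Omega>. weak_gradient \<Omega> u x = G x"
  by (rule is_weak_gradient_AE_unique[OF assms(1) is_weak_gradient_weak_gradient assms(3)])
    (use assms in \<open>auto simp: H1_def\<close>)

text \<open>Two scalars are carried so that sums, differences and multiples are special cases; the
  same form recurs for stresses and their divergences.\<close>

lemma is_weak_gradient_combination:
  assumes \<Omega>: "\<Omega> \<in> sets lebesgue" and u: "u \<in> L2 \<Omega>" "is_weak_gradient \<Omega> u G"
    and v: "v \<in> L2 \<Omega>" "is_weak_gradient \<Omega> v H"
  shows "is_weak_gradient \<Omega> (\<lambda>x. a *\<^sub>R u x + b *\<^sub>R v x) (\<lambda>x. a *\<^sub>R G x + b *\<^sub>R H x)"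
  unfolding is_weak_gradient_def
proof (intro conjI ballI allI)
  show "(\<lambda>x. a *\<^sub>R G x + b *\<^sub>R H x) \<in> L2 \<Omega>"
    using u v by (intro L2_add L2_scaleR) (auto simp: is_weak_gradient_def)
  fix \<phi> :: "real^'a \<Rightarrow> real" and i j
  assume \<phi>: "\<phi> \<in> test_functions \<Omega>"
  have int1: "integrable (lebesgue_on \<Omega>) (\<lambda>x. w x $ i * frechet_derivative \<phi> (at x) (axis j 1))"
    if "w \<in> L2 \<Omega>" for w :: "real^'a \<Rightarrow> real^'a"
    using that by (intro integrable_mult_L2 test_function_derivative_L2[OF \<Omega> \<phi>]) (simp add: L2_vec_iff)
  have int2: "integrable (lebesgue_on \<Omega>) (\<lambda>x. W x $ i $ j * \<phi> x)"
    if "W \<in> L2 \<Omega>" for W :: "real^'a \<Rightarrow> real^'a^'a"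
    using that by (intro integrable_mult_L2 test_function_L2[OF \<Omega> \<phi>]) (simp add: L2_vec_iff)
  have "G \<in> L2 \<Omega>" "H \<in> L2 \<Omega>"
    using u v by (simp_all add: is_weak_gradient_def)
  then show "(\<integral>x. (a *\<^sub>R u x + b *\<^sub>R v x) $ i * frechet_derivative \<phi> (at x) (axis j 1) \<partial>lebesgue_on \<Omega>)
      = - (\<integral>x. (a *\<^sub>R G x + b *\<^sub>R H x) $ i $ j * \<phi> x \<partial>lebesgue_on \<Omega>)"
    using int1[OF u(1)] int1[OF v(1)] int2[of G] int2[of H]
      is_weak_gradientD[OF u(2) \<phi>, of i j] is_weak_gradientD[OF v(2) \<phi>, of i j]
    by (simp add: distrib_right mult.assoc)
qed

lemma H1_combination:
  assumes "\<Omega> \<in> sets lebesgue" "u \<in> H1 \<Omega>" "v \<in> H1 \<Omega>"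
  shows "(\<lambda>x. a *\<^sub>R u x + b *\<^sub>R v x) \<in> H1 \<Omega>"
  using assms is_weak_gradient_combination[of \<Omega> u _ v _ a b]
  by (auto simp: H1_def intro!: L2_add L2_scaleR)

lemma weak_gradient_combination:
  assumes \<Omega>: "open \<Omega>" and u: "u \<in> H1 \<Omega>" and v: "v \<in> H1 \<Omega>"
  shows "AE x in lebesgue_on \<Omega>. weak_gradient \<Omega> (\<lambda>x. a *\<^sub>R u x + b *\<^sub>R v x) x
    = a *\<^sub>R weak_gradient \<Omega> u x + b *\<^sub>R weak_gradient \<Omega> v x"
proof -
  have "\<Omega> \<in> sets lebesgue"
    using \<Omega> by auto
  note combination = is_weak_gradient_combination[OF this _ is_weak_gradient_weak_gradient[OF u]
      _ is_weak_gradient_weak_gradient[OF v], of a b]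
  have L2: "u \<in> L2 \<Omega>" "v \<in> L2 \<Omega>"
    using u v by (auto simp: H1_def)
  then show ?thesis
    by (intro weak_gradient_AE_eq[OF \<Omega> _ combination] L2_add[OF L2_scaleR L2_scaleR])
qed

lemma test_function_H1:
  assumes "\<Omega> \<in> sets lebesgue" "g \<in> test_functions \<Omega>"
  shows "g \<in> H1 \<Omega>"
  using test_function_L2[OF assms] is_weak_gradient_jacobian[OF assms] by (auto simp: H1_def)

lemma weak_gradient_test_function:
  assumes \<Omega>: "open \<Omega>" and g: "g \<in> test_functions \<Omega>"
  shows "AE x in lebesgue_on \<Omega>. weak_gradient \<Omega> g x = jacobian g (at x)"
proof -
  have "\<Omega> \<in> sets lebesgue"
    using \<Omega> by auto
  from weak_gradient_AE_eq[OF \<Omega> test_function_L2[OF this g] is_weak_gradient_jacobian[OF this g]]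
  show ?thesis .
qed

text \<open>Even for the zero field the chosen weak gradient is zero only almost everywhere. The
  statement serves the constant approximating sequence that puts test functions into
  \<open>H10\<close>.\<close>

lemma H1_norm_zero:
  assumes "open \<Omega>"
  shows "H1_norm \<Omega> 0 = 0"
proof -
  have zero: "is_weak_gradient \<Omega> 0 (\<lambda>x. 0)"
    by (simp add: is_weak_gradient_def L2_zero)
  have L2: "(0 :: real^'a \<Rightarrow> real^'a) \<in> L2 \<Omega>"
    by (simp add: zero_fun_def L2_zero)
  with zero have "weak_gradient \<Omega> 0 \<in> L2 \<Omega>"
    by (intro weak_gradient_L2) (auto simp: H1_def)
  then have "L2_inner \<Omega> (weak_gradient \<Omega> 0) (weak_gradient \<Omega> 0) = L2_inner \<Omega> (\<lambda>x. 0 :: real^'a^'a) (\<lambda>x. 0)"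
    by (intro L2_inner_cong_AE L2_zero weak_gradient_AE_eq[OF assms L2 zero])
  then show ?thesis
    by (simp add: H1_norm_def L2_norm_def L2_inner_def)
qed

lemma test_function_H10:
  assumes \<Omega>: "open \<Omega>" and g: "g \<in> test_functions \<Omega>"
  shows "g \<in> H10 \<Omega>"
proof -
  have "g \<in> H1 \<Omega>"
    using \<Omega> by (intro test_function_H1 g) auto
  moreover have "(\<lambda>n::nat. H1_norm \<Omega> (g - g)) \<longlonglongrightarrow> 0"
    using H1_norm_zero[OF \<Omega>] by simp
  ultimately show ?thesis
    unfolding H10_def using g by (intro CollectI conjI exI[of _ "\<lambda>_. g"]) auto
qed

subsection \<open>Stress, divergence and the flux norm\<close>

lemma L2_mult_bounded:
  fixes c f :: "real^'d \<Rightarrow> real"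
  assumes "f \<in> L2 \<Omega>" "c \<in> borel_measurable (lebesgue_on \<Omega>)" "AE x in lebesgue_on \<Omega>. \<bar>c x\<bar> \<le> M"
  shows "(\<lambda>x. c x * f x) \<in> L2 \<Omega>"
proof (rule L2_bound[OF assms(1), where c = M])
  show "(\<lambda>x. c x * f x) \<in> borel_measurable (lebesgue_on \<Omega>)"
    using assms(2) L2_measurable[OF assms(1)] by measurable
  show "AE x in lebesgue_on \<Omega>. norm (c x * f x) \<le> M * norm (f x)"
    using assms(3) by eventually_elim (simp add: abs_mult mult_right_mono)
qed

lemma stress_L2:
  assumes C: "elasticity_tensor \<Omega> C" and u: "u \<in> H1 \<Omega>"
  shows "stress \<Omega> C u \<in> L2 \<Omega>"
proof -
  have grad: "(\<lambda>x. weak_gradient \<Omega> u x $ k $ l) \<in> L2 \<Omega>" for k l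
    using weak_gradient_L2[OF u] by (simp add: L2_vec_iff)
  have strain: "(\<lambda>x. strain \<Omega> u x $ k $ l) \<in> L2 \<Omega>" for k l
    using L2_scaleR[OF L2_add[OF grad[of k l] grad[of l k]], of "1 / 2"] by (simp add: strain_def)
  have "(\<lambda>x. C x $ i $ j $ k $ l * strain \<Omega> u x $ k $ l) \<in> L2 \<Omega>" for i j k l
  proof -
    have "(\<lambda>x. C x $ i $ j $ k $ l) \<in> borel_measurable (lebesgue_on \<Omega>)"
      "\<exists>M. AE x in lebesgue_on \<Omega>. \<bar>C x $ i $ j $ k $ l\<bar> \<le> M"
      using C unfolding elasticity_tensor_def by blast+
    then show ?thesis
      using L2_mult_bounded[OF strain] by blast
  qed
  then have "(\<lambda>x. stress \<Omega> C u x $ i $ j) \<in> L2 \<Omega>" for i j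
    unfolding stress_def tensor_apply_def by (simp add: L2_sum)
  then show ?thesis
    by (simp add: L2_vec_iff)
qed

text \<open>\<open>strain\<close> and \<open>tensor_apply\<close> are linear pointwise; the
  exceptional null set comes solely from the chosen weak gradients.\<close>

lemma stress_combination:
  assumes "open \<Omega>" "u \<in> H1 \<Omega>" "v \<in> H1 \<Omega>"
  shows "AE x in lebesgue_on \<Omega>. stress \<Omega> C (\<lambda>x. a *\<^sub>R u x + b *\<^sub>R v x) x
    = a *\<^sub>R stress \<Omega> C u x + b *\<^sub>R stress \<Omega> C v x"
  using weak_gradient_combination[OF assms, of a b]
proof eventually_elim
  case (elim x)
  have strain: "strain \<Omega> (\<lambda>x. a *\<^sub>R u x + b *\<^sub>R v x) x = a *\<^sub>R strain \<Omega> u x + b *\<^sub>R strain \<Omega> v x"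
    by (simp add: strain_def elim vec_eq_iff field_simps)
  show ?case
    unfolding stress_def strain
    by (simp add: tensor_apply_def vec_eq_iff sum_distrib_left sum.distrib[symmetric] algebra_simps)
qed

text \<open>An equality of functions, with no exceptional set left: the almost everywhere identity
  for stresses disappears in the integral, and off \<open>H10 \<Omega>\<close> every functional is 0
  by convention.\<close>

lemma div_functional_stress_combination:
  assumes \<Omega>: "open \<Omega>" and C: "elasticity_tensor \<Omega> C" and u: "u \<in> H1 \<Omega>" and v: "v \<in> H1 \<Omega>"
  shows "div_functional \<Omega> (stress \<Omega> C (a *\<^sub>R u + b *\<^sub>R v))
    = a *\<^sub>R div_functional \<Omega> (stress \<Omega> C u) + b *\<^sub>R div_functional \<Omega> (stress \<Omega> C v)"
proof
  fix \<phi>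
  let ?w = "\<lambda>x. a *\<^sub>R u x + b *\<^sub>R v x"
  have w: "a *\<^sub>R u + b *\<^sub>R v = ?w"
    by (simp add: fun_eq_iff scaleR_fun_def)
  have "?w \<in> H1 \<Omega>"
    using \<Omega> u v by (intro H1_combination) auto
  note L2 = stress_L2[OF C this] stress_L2[OF C u] stress_L2[OF C v]
  show "div_functional \<Omega> (stress \<Omega> C (a *\<^sub>R u + b *\<^sub>R v)) \<phi>
    = (a *\<^sub>R div_functional \<Omega> (stress \<Omega> C u) + b *\<^sub>R div_functional \<Omega> (stress \<Omega> C v)) \<phi>"
  proof (cases "\<phi> \<in> H10 \<Omega>")
    case True
    then have G: "weak_gradient \<Omega> \<phi> \<in> L2 \<Omega>"
      by (intro weak_gradient_L2) (simp add: H10_def)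
    have "L2_inner \<Omega> (stress \<Omega> C ?w) (weak_gradient \<Omega> \<phi>)
        = L2_inner \<Omega> (\<lambda>x. a *\<^sub>R stress \<Omega> C u x + b *\<^sub>R stress \<Omega> C v x) (weak_gradient \<Omega> \<phi>)"
      by (rule L2_inner_cong_AE[OF L2(1) L2_add[OF L2_scaleR[OF L2(2)] L2_scaleR[OF L2(3)]] G G
            stress_combination[OF \<Omega> u v]]) simp
    also have "\<dots> = a * L2_inner \<Omega> (stress \<Omega> C u) (weak_gradient \<Omega> \<phi>)
        + b * L2_inner \<Omega> (stress \<Omega> C v) (weak_gradient \<Omega> \<phi>)"
      by (simp add: L2_inner_add_left[OF L2_scaleR[OF L2(2)] L2_scaleR[OF L2(3)] G] L2_inner_scaleR_left)
    finally show ?thesis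
      unfolding w using True by (simp add: div_functional_def scaleR_fun_def)
  qed (simp add: div_functional_def scaleR_fun_def)
qed

text \<open>By linearity the image is already a subspace, hence its own span. Each element of
  \<open>div_space\<close> is thus attained by a single \<open>v\<close>, as the matching of infima
  requires.\<close>

lemma div_space_eq_image:
  assumes \<Omega>: "open \<Omega>" and C: "elasticity_tensor \<Omega> C" and V: "finite_dim_subspace_H10 \<Omega> V"
  shows "div_space \<Omega> C V = (\<lambda>v. div_functional \<Omega> (stress \<Omega> C v)) ` V"
proof -
  have sub: "subspace V" and H1: "v \<in> V \<Longrightarrow> v \<in> H1 \<Omega>" for v
    using V by (auto simp: finite_dim_subspace_H10_def H10_def)
  let ?D = "\<lambda>v. div_functional \<Omega> (stress \<Omega> C v)"
  have comb: "a *\<^sub>R ?D v + b *\<^sub>R ?D w \<in> ?D ` V" if "v \<in> V" "w \<in> V" for a b v w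
    using div_functional_stress_combination[OF \<Omega> C H1 H1, OF that, of a b] that
    by (intro image_eqI[of _ _ "a *\<^sub>R v + b *\<^sub>R w"]) (auto intro: subspace_add subspace_scale sub)
  have "subspace (?D ` V)"
  proof (rule subspaceI)
    have "0 \<in> V"
      using sub by (rule subspace_0)
    from comb[OF this this, of 0 0] show "0 \<in> ?D ` V"
      by simp
    show "x + y \<in> ?D ` V" if "x \<in> ?D ` V" "y \<in> ?D ` V" for x y
      using that comb[of _ _ 1 1] by auto
    show "c *\<^sub>R x \<in> ?D ` V" if "x \<in> ?D ` V" for c x
      using that comb[of _ _ c 0] by auto
  qed
  then show ?thesis
    by (simp add: div_space_def)
qed

section \<open>The potential part depends only on the divergence\<close>

lemma L2_inner_potential_cong:
  assumes \<Omega>: "\<Omega> \<in> sets lebesgue" and k: "k \<in> L2 \<Omega>" "k' \<in> L2 \<Omega>"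
    and eq: "\<And>g. g \<in> test_functions \<Omega> \<Longrightarrow>
      L2_inner \<Omega> k (\<lambda>x. jacobian g (at x)) = L2_inner \<Omega> k' (\<lambda>x. jacobian g (at x))"
    and q: "q \<in> potential_fields \<Omega>"
  shows "L2_inner \<Omega> k q = L2_inner \<Omega> k' q"
proof -
  obtain g :: "nat \<Rightarrow> real^'a \<Rightarrow> real^'a" where g: "\<And>n. g n \<in> test_functions \<Omega>"
    and lim: "(\<lambda>n. L2_norm \<Omega> (\<lambda>x. q x - jacobian (g n) (at x))) \<longlonglongrightarrow> 0" and L2: "q \<in> L2 \<Omega>"
    using q unfolding potential_fields_def by blast
  note tendsto = L2_inner_tendsto[OF _ L2 jacobian_L2[OF \<Omega> g] lim]
  show ?thesis
    using tendsto[OF k(1)] tendsto[OF k(2)] unfolding eq[OF g] by (rule LIMSEQ_unique)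
qed

text \<open>The two defining predicates of the projection coincide, so the choice operator selects the same
  field; existence of the projection plays no role.\<close>

lemma pot_cong:
  assumes \<Omega>: "\<Omega> \<in> sets lebesgue" and k: "k \<in> L2 \<Omega>" "k' \<in> L2 \<Omega>"
    and eq: "\<And>g. g \<in> test_functions \<Omega> \<Longrightarrow>
      L2_inner \<Omega> k (\<lambda>x. jacobian g (at x)) = L2_inner \<Omega> k' (\<lambda>x. jacobian g (at x))"
  shows "pot \<Omega> k = pot \<Omega> k'"
proof -
  have "L2_inner \<Omega> (k - p) q = L2_inner \<Omega> (k' - p) q"
    if p: "p \<in> potential_fields \<Omega>" and q: "q \<in> potential_fields \<Omega>" for p q
  proof -
    have "p \<in> L2 \<Omega>" "q \<in> L2 \<Omega>"
      using p q by (auto simp: potential_fields_def)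
    then show ?thesis
      using L2_inner_potential_cong[OF \<Omega> k eq q]
      by (simp add: fun_diff_def L2_inner_diff_left k)
  qed
  then have "(p \<in> potential_fields \<Omega> \<and> (\<forall>q\<in>potential_fields \<Omega>. L2_inner \<Omega> (k - p) q = 0)) \<longleftrightarrow>
      (p \<in> potential_fields \<Omega> \<and> (\<forall>q\<in>potential_fields \<Omega>. L2_inner \<Omega> (k' - p) q = 0))" for p
    by auto
  then show ?thesis
    unfolding pot_def by presburger
qed

text \<open>The bridge between the classical gradients that define the projection and the weak ones
  inside \<open>div_functional\<close>; they agree almost everywhere on test functions.\<close>

lemma L2_inner_jacobian_eq_div_functional:
  assumes \<Omega>: "open \<Omega>" and k: "k \<in> L2 \<Omega>" and g: "g \<in> test_functions \<Omega>"
  shows "L2_inner \<Omega> k (\<lambda>x. jacobian g (at x)) = - div_functional \<Omega> k g"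
proof -
  have \<Omega>': "\<Omega> \<in> sets lebesgue"
    using \<Omega> by auto
  have "L2_inner \<Omega> k (weak_gradient \<Omega> g) = L2_inner \<Omega> k (\<lambda>x. jacobian g (at x))"
    by (rule L2_inner_cong_AE[OF k k weak_gradient_L2[OF test_function_H1[OF \<Omega>' g]] jacobian_L2[OF \<Omega>' g]
          _ weak_gradient_test_function[OF \<Omega> g]]) simp
  then show ?thesis
    by (simp add: div_functional_def test_function_H10[OF \<Omega> g])
qed

text \<open>Two tensors and two fields are compared through their divergences alone, which is what
  permits exchanging \<open>C\<close> for \<open>C'\<close>.\<close>

lemma flux_norm_cong:
  assumes \<Omega>: "open \<Omega>" and C: "elasticity_tensor \<Omega> C" "elasticity_tensor \<Omega> C'"
    and w: "w \<in> H1 \<Omega>" "w' \<in> H1 \<Omega>"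
    and eq: "div_functional \<Omega> (stress \<Omega> C w) = div_functional \<Omega> (stress \<Omega> C' w')"
  shows "flux_norm \<Omega> C w = flux_norm \<Omega> C' w'"
proof -
  note L2 = stress_L2[OF C(1) w(1)] stress_L2[OF C(2) w(2)]
  have "pot \<Omega> (stress \<Omega> C w) = pot \<Omega> (stress \<Omega> C' w')"
    using \<Omega> by (intro pot_cong L2) (auto simp: L2_inner_jacobian_eq_div_functional[OF \<Omega>] L2 eq)
  then show ?thesis
    by (simp add: flux_norm_def)
qed

text \<open>Given \<open>v\<close>, choose \<open>v'\<close> with the same divergence of stress. The
  two solutions also share theirs, both being the negative of the functional of \<open>b\<close>, so
  by linearity the differences do. Only one inclusion is stated; exchanging the roles gives the
  other.\<close>

lemma flux_norm_image_subset:
  assumes \<Omega>: "open \<Omega>" and C: "elasticity_tensor \<Omega> C" "elasticity_tensor \<Omega> C'"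
    and V: "finite_dim_subspace_H10 \<Omega> V" "finite_dim_subspace_H10 \<Omega> V'"
    and w: "weak_solution \<Omega> C b w" "weak_solution \<Omega> C' b w'"
    and sub: "div_space \<Omega> C V \<subseteq> div_space \<Omega> C' V'"
  shows "(\<lambda>v. flux_norm \<Omega> C (w - v)) ` V \<subseteq> (\<lambda>v. flux_norm \<Omega> C' (w' - v)) ` V'"
proof
  fix r assume "r \<in> (\<lambda>v. flux_norm \<Omega> C (w - v)) ` V"
  then obtain v where v: "v \<in> V" and r: "r = flux_norm \<Omega> C (w - v)"
    by blast
  then obtain v' where v': "v' \<in> V'"
    and eq: "div_functional \<Omega> (stress \<Omega> C v) = div_functional \<Omega> (stress \<Omega> C' v')"
    using sub unfolding div_space_eq_image[OF \<Omega> C(1) V(1)] div_space_eq_image[OF \<Omega> C(2) V(2)] by blast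
  have H1: "w \<in> H1 \<Omega>" "w' \<in> H1 \<Omega>" "v \<in> H1 \<Omega>" "v' \<in> H1 \<Omega>"
    using w V v v' by (auto simp: weak_solution_def finite_dim_subspace_H10_def H10_def)
  have diff: "x - y = 1 *\<^sub>R x + (-1) *\<^sub>R y" for x y :: "real^'a \<Rightarrow> real^'a"
    by simp
  have diff_H1: "x - y \<in> H1 \<Omega>" if "x \<in> H1 \<Omega>" "y \<in> H1 \<Omega>" for x y
    using H1_combination[OF _ that, of 1 "-1"] \<Omega> by (simp add: fun_diff_def)
  have "div_functional \<Omega> (stress \<Omega> C w) = div_functional \<Omega> (stress \<Omega> C' w')"
    using w unfolding weak_solution_def by (metis minus_minus)
  then have "div_functional \<Omega> (stress \<Omega> C (w - v)) = div_functional \<Omega> (stress \<Omega> C' (w' - v'))"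
    unfolding diff div_functional_stress_combination[OF \<Omega> C(1) H1(1,3)]
      div_functional_stress_combination[OF \<Omega> C(2) H1(2,4)] eq by simp
  then have "r = flux_norm \<Omega> C' (w' - v')"
    unfolding r by (intro flux_norm_cong \<Omega> C diff_H1 H1)
  with v' show "r \<in> (\<lambda>v. flux_norm \<Omega> C' (w' - v)) ` V'"
    by blast
qed

theorem theorem2p3:
  fixes \<Omega> :: "(real^'d) set"
    and C C' :: "real^'d \<Rightarrow> real^'d^'d^'d^'d"
    and V V' :: "(real^'d \<Rightarrow> real^'d) set"
    and u u' :: "(real^'d \<Rightarrow> real^'d) \<Rightarrow> (real^'d \<Rightarrow> real^'d)"
  assumes "CARD('d) \<ge> 2"
    and "C2_bounded_domain \<Omega>"
    and "elasticity_tensor \<Omega> C"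
    and "elasticity_tensor \<Omega> C'"
    and "finite_dim_subspace_H10 \<Omega> V"
    and "finite_dim_subspace_H10 \<Omega> V'"
    and "\<And>b. b \<in> L2 \<Omega> \<Longrightarrow> weak_solution \<Omega> C b (u b)"
    and "\<And>b. b \<in> L2 \<Omega> \<Longrightarrow> weak_solution \<Omega> C' b (u' b)"
    and "div_space \<Omega> C V = div_space \<Omega> C' V'"
  shows "(SUP b\<in>{b \<in> L2 \<Omega>. L2_norm \<Omega> b \<noteq> 0}. INF v\<in>V. ereal (flux_norm \<Omega> C (u b - v) / L2_norm \<Omega> b))
       = (SUP b\<in>{b \<in> L2 \<Omega>. L2_norm \<Omega> b \<noteq> 0}. INF v\<in>V'. ereal (flux_norm \<Omega> C' (u' b - v) / L2_norm \<Omega> b))"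
proof (rule SUP_cong[OF refl])
  fix b :: "real^'d \<Rightarrow> real^'d"
  assume "b \<in> {b \<in> L2 \<Omega>. L2_norm \<Omega> b \<noteq> 0}"
  then have b: "b \<in> L2 \<Omega>"
    by simp
  have \<Omega>: "open \<Omega>"
    using assms(2) by (simp add: C2_bounded_domain_def)
  have "(\<lambda>v. flux_norm \<Omega> C (u b - v)) ` V = (\<lambda>v. flux_norm \<Omega> C' (u' b - v)) ` V'"
    using flux_norm_image_subset[OF \<Omega> assms(3-6) assms(7,8)[OF b]]
      flux_norm_image_subset[OF \<Omega> assms(4,3,6,5) assms(8,7)[OF b]] assms(9) by blast
  \<comment> \<open>Both quotients are the same function of the flux norm, so equal sets of flux
    norms give equal sets under the two infima.\<close>
  then have "(\<lambda>r. ereal (r / L2_norm \<Omega> b)) ` (\<lambda>v. flux_norm \<Omega> C (u b - v)) ` V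
      = (\<lambda>r. ereal (r / L2_norm \<Omega> b)) ` (\<lambda>v. flux_norm \<Omega> C' (u' b - v)) ` V'"
    by simp
  then show "(INF v\<in>V. ereal (flux_norm \<Omega> C (u b - v) / L2_norm \<Omega> b))
      = (INF v\<in>V'. ereal (flux_norm \<Omega> C' (u' b - v) / L2_norm \<Omega> b))"
    by (simp add: image_image)
qed

end
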